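(* Let $\Bbbk$ be a field, let $(L_1,L_0,\partial)$ be a crossed module of Leibniz algebras over $\Bbbk$, and let $G=L_1\rtimes L_0$ be the corresponding internal groupoid in the category $\mathsf{Lbnz}$ of Leibniz algebras. Then the category $\mathsf{Cov}_{\mathsf{XMod(Lbnz)}}/(L_1,L_0,\partial)$ of coverings of $(L_1,L_0,\partial)$ and the category $\mathsf{Cov}_{\mathsf{Cat(Lbnz)}}/G$ of covering internal groupoids of $G$ are equivalent.
   Context: A Leibniz algebra is a $\Bbbk$-vector space $L$ with a bilinear map $[-,-]\colon L\times L\to L$ satisfying $[x,[y,z]]=[[x,y],z]-[[x,z],y]$ for all $x,y,z\in L$. A Leibniz algebra morphism is a $\Bbbk$-linear map preserving brackets. Pullbacks are regarded as subalgebras of products with componentwise operations. A Leibniz action of $L$ on $L'$ consists of two bilinear maps $L\times L'\to L'$, $(x,m)\mapsto x\cdot m$, and $L'\times L\to L'$, $(m,x)\mapsto m\cdot x$, such that for all $x,y\in L$, $m,n\in L'$: (i) $x\cdot[m,n]=[x\cdot m,n]-[x\cdot n,m]$; (ii) $[m,x\cdot n]=[m\cdot x,n]-[m,n]\cdot x$; (iii) $[m,n\cdot x]=[m,n]\cdot x-[m\cdot x,n]$; (iv) $x\cdot(y\cdot m)=[x,y]\cdot m-(x\cdot m)\cdot y$; (v) $x\cdot(m\cdot y)=(x\cdot m)\cdot y-[x,y]\cdot m$; (vi) $m\cdot[x,y]=(m\cdot x)\cdot y-(m\cdot y)\cdot x$. The semi-direct product $L'\rtimes L$ is the vector space $L'\times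 L$ with bracket $[(m,x),(n,y)]=([m,n]+m\cdot y+x\cdot n,[x,y])$. A crossed module $(L_1,L_0,\partial)$ of Leibniz algebras is a Leibniz algebra morphism $\partial\colon L_1\to L_0$ together with a Leibniz action of $L_0$ on $L_1$ such that for all $l_0\in L_0$, $l_1,l_1'\in L_1$: $\partial(l_0\cdot l_1)=[l_0,\partial(l_1)]$, $\partial(l_1\cdot l_0)=[\partial(l_1),l_0]$, $l_1\cdot\partial(l_1')=[l_1,l_1']$, and $\partial(l_1')\cdot l_1=[l_1',l_1]$. A morphism $(L_1,L_0,\partial)\to(M_1,M_0,\delta)$ is a pair $(f_1,f_0)$ of Leibniz algebra morphisms $f_1\colon L_1\to M_1$, $f_0\colon L_0\to M_0$ with $f_0\partial=\delta f_1$, $f_1(l_0\cdot l_1)=f_0(l_0)\cdot f_1(l_1)$ and $f_1(l_1\cdot l_0)=f_1(l_1)\cdot f_0(l_0)$. A covering of $(L_1,L_0,\partial)$ is a crossed module morphism $(p_1,p_0)\colon(\widetilde L_1,\widetilde L_0,\widetilde\partial)\to(L_1,L_0,\partial)$ such that $p_1\colon\widetilde L_1\to L_1$ is an isomorphism of Leibniz algebras. The objects of $\mathsf{Cov}_{\mathsf{XMod(Lbnz)}}/(L_1,L_0,\partial)$ are these coverings; a morphism from $(p_1,p_0)$ to $(q_1,q_0)\colon(L_1',L_0',\partial')\to(L_1,L_0,\partial)$ is a crossed module morphism $(f_1,f_0)\colon(\widetilde L_1,\widetilde L_0,\widetilde\partial)\to(L_1',L_0',\partial')$ with $q_1f_1=p_1$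 and $q_0f_0=p_0$. An internal groupoid $G$ in $\mathsf{Lbnz}$ is a groupoid whose set of morphisms (also denoted $G$) and set of objects $\mathrm{Ob}(G)$ are Leibniz algebras, such that the source and target maps $d_0,d_1\colon G\to \mathrm{Ob}(G)$, the identity map $\varepsilon\colon \mathrm{Ob}(G)\to G$, and the composition $\{(h,g)\in G\times G: d_0(h)=d_1(g)\}\to G$, $(h,g)\mapsto h\circ g$, are Leibniz algebra morphisms. A morphism of internal groupoids is a functor that is a Leibniz algebra morphism both on morphisms and on objects; write $\mathrm{Ob}(p)$ for the object map of $p$. The internal groupoid corresponding to $(L_1,L_0,\partial)$ has algebra of morphisms $G=L_1\rtimes L_0$ and algebra of objects $L_0$, with $d_0(l_1,l_0)=l_0$, $d_1(l_1,l_0)=\partial(l_1)+l_0$, $\varepsilon(l_0)=(0,l_0)$, and $(l_1',l_0')\circ(l_1,l_0)=(l_1'+l_1,l_0)$ when $l_0'=\partial(l_1)+l_0$. A morphism of internal groupoids $p\colon\widetilde G\to G$ is a covering morphism if $(p,d_0)\colon \widetilde G\to G\,{}_{d_0}\!\times_{\mathrm{Ob}(p)}\mathrm{Ob}(\widetilde G)=\{(g,\widetilde x): d_0(g)=\mathrm{Ob}(p)(\widetilde x)\}$ is an isomorphism in $\mathsf{Lbnz}$. The objects of $\mathsf{Cov}_{\mathsf{Cat(Lbnz)}}/G$ are the covering morphisms $p\colon \widetilde G\to G$; a morphism from $p\colon\widetilde G\to G$ to $q\colon G'\to G$ is a morphism of internal groupoids $f\colon\widetilde G\to G'$ with $qf=p$.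 *)

theory Defs
  imports "HOL-Algebra.Module"
begin

section \<open>Leibniz algebras over a field\<close>

definition bilinear_map ::
  "'k ring \<Rightarrow> ('k, 'a) module \<Rightarrow> ('k, 'b) module \<Rightarrow> ('k, 'c) module \<Rightarrow> ('a \<Rightarrow> 'b \<Rightarrow> 'c) \<Rightarrow> bool" where
  "bilinear_map K U V W \<beta> \<longleftrightarrow>
     (\<forall>u \<in> carrier U. \<forall>v \<in> carrier V. \<beta> u v \<in> carrier W) \<and>
     (\<forall>u \<in> carrier U. \<forall>u' \<in> carrier U. \<forall>v \<in> carrier V.
        \<beta> (u \<oplus>\<^bsub>U\<^esub> u') v = \<beta> u v \<oplus>\<^bsub>W\<^esub> \<beta> u' v) \<and>
     (\<forall>u \<in> carrier U. \<forall>v \<in> carrier V. \<forall>v' \<in> carrier V.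
        \<beta> u (v \<oplus>\<^bsub>V\<^esub> v') = \<beta> u v \<oplus>\<^bsub>W\<^esub> \<beta> u v') \<and>
     (\<forall>c \<in> carrier K. \<forall>u \<in> carrier U. \<forall>v \<in> carrier V.
        \<beta> (c \<odot>\<^bsub>U\<^esub> u) v = c \<odot>\<^bsub>W\<^esub> \<beta> u v) \<and>
     (\<forall>c \<in> carrier K. \<forall>u \<in> carrier U. \<forall>v \<in> carrier V.
        \<beta> u (c \<odot>\<^bsub>V\<^esub> v) = c \<odot>\<^bsub>W\<^esub> \<beta> u v)"

text \<open>The bracket $[x,y]$ is the multiplication field of the module record, written
  \<open>x \<otimes>\<^bsub>L\<^esub> y\<close>; the locale \<open>module\<close> puts no condition on that field. The field \<open>one\<close> of
  the record plays no role.\<close>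

locale leibniz_algebra = K?: field K + module K L
  for K :: "'k ring" (structure) and L :: "('k, 'a) module" (structure) +
  assumes bracket_bilinear: "bilinear_map K L L L (\<lambda>x y. x \<otimes>\<^bsub>L\<^esub> y)"
    and leibniz_identity:
      "\<lbrakk>x \<in> carrier L; y \<in> carrier L; z \<in> carrier L\<rbrakk> \<Longrightarrow>
        x \<otimes>\<^bsub>L\<^esub> (y \<otimes>\<^bsub>L\<^esub> z) = ((x \<otimes>\<^bsub>L\<^esub> y) \<otimes>\<^bsub>L\<^esub> z) \<ominus>\<^bsub>L\<^esub> ((x \<otimes>\<^bsub>L\<^esub> z) \<otimes>\<^bsub>L\<^esub> y)"

definition leibniz_hom ::
  "'k ring \<Rightarrow> ('k, 'a) module \<Rightarrow> ('k, 'b) module \<Rightarrow> ('a \<Rightarrow> 'b) set" where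
  "leibniz_hom K L M = {f \<in> carrier L \<rightarrow> carrier M.
     (\<forall>x \<in> carrier L. \<forall>y \<in> carrier L. f (x \<oplus>\<^bsub>L\<^esub> y) = f x \<oplus>\<^bsub>M\<^esub> f y) \<and>
     (\<forall>c \<in> carrier K. \<forall>x \<in> carrier L. f (c \<odot>\<^bsub>L\<^esub> x) = c \<odot>\<^bsub>M\<^esub> f x) \<and>
     (\<forall>x \<in> carrier L. \<forall>y \<in> carrier L. f (x \<otimes>\<^bsub>L\<^esub> y) = f x \<otimes>\<^bsub>M\<^esub> f y)}"

definition leibniz_iso ::
  "'k ring \<Rightarrow> ('k, 'a) module \<Rightarrow> ('k, 'b) module \<Rightarrow> ('a \<Rightarrow> 'b) set" where
  "leibniz_iso K L M = {f \<in> leibniz_hom K L M. \<exists>g \<in> leibniz_hom K M L.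
     (\<forall>x \<in> carrier L. g (f x) = x) \<and> (\<forall>y \<in> carrier M. f (g y) = y)}"

definition leibniz_prod :: "('k, 'a) module \<Rightarrow> ('k, 'b) module \<Rightarrow> ('k, 'a \<times> 'b) module" where
  "leibniz_prod L M =
    \<lparr>carrier = carrier L \<times> carrier M,
     mult = (\<lambda>(x, y) (x', y'). (x \<otimes>\<^bsub>L\<^esub> x', y \<otimes>\<^bsub>M\<^esub> y')),
     one = undefined,
     zero = (\<zero>\<^bsub>L\<^esub>, \<zero>\<^bsub>M\<^esub>),
     add = (\<lambda>(x, y) (x', y'). (x \<oplus>\<^bsub>L\<^esub> x', y \<oplus>\<^bsub>M\<^esub> y')),
     smult = (\<lambda>c (x, y). (c \<odot>\<^bsub>L\<^esub> x, c \<odot>\<^bsub>M\<^esub> y))\<rparr>"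

definition leibniz_pullback ::
  "('k, 'a) module \<Rightarrow> ('k, 'b) module \<Rightarrow> ('a \<Rightarrow> 'c) \<Rightarrow> ('b \<Rightarrow> 'c) \<Rightarrow> ('k, 'a \<times> 'b) module" where
  "leibniz_pullback L M f g =
     (leibniz_prod L M)\<lparr>carrier := {(x, y). x \<in> carrier L \<and> y \<in> carrier M \<and> f x = g y}\<rparr>"


section \<open>Actions and crossed modules\<close>

text \<open>\<open>leibniz_action K L L' la ra\<close>: the algebra \<open>L\<close> acts on \<open>L'\<close>, with $x\cdot m$ given by
  \<open>la x m\<close> and $m\cdot x$ by \<open>ra m x\<close>.\<close>

definition leibniz_action ::
  "'k ring \<Rightarrow> ('k, 'b) module \<Rightarrow> ('k, 'a) module \<Rightarrow> ('b \<Rightarrow> 'a \<Rightarrow> 'a) \<Rightarrow> ('a \<Rightarrow> 'b \<Rightarrow> 'a) \<Rightarrow> bool" where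
  "leibniz_action K L L' la ra \<longleftrightarrow>
     bilinear_map K L L' L' la \<and> bilinear_map K L' L L' ra \<and>
     (\<forall>x \<in> carrier L. \<forall>m \<in> carrier L'. \<forall>n \<in> carrier L'.
        la x (m \<otimes>\<^bsub>L'\<^esub> n) = (la x m \<otimes>\<^bsub>L'\<^esub> n) \<ominus>\<^bsub>L'\<^esub> (la x n \<otimes>\<^bsub>L'\<^esub> m) \<and>
        m \<otimes>\<^bsub>L'\<^esub> la x n = (ra m x \<otimes>\<^bsub>L'\<^esub> n) \<ominus>\<^bsub>L'\<^esub> ra (m \<otimes>\<^bsub>L'\<^esub> n) x \<and>
        m \<otimes>\<^bsub>L'\<^esub> ra n x = ra (m \<otimes>\<^bsub>L'\<^esub> n) x \<ominus>\<^bsub>L'\<^esub> (ra m x \<otimes>\<^bsub>L'\<^esub> n)) \<and>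
     (\<forall>x \<in> carrier L. \<forall>y \<in> carrier L. \<forall>m \<in> carrier L'.
        la x (la y m) = la (x \<otimes>\<^bsub>L\<^esub> y) m \<ominus>\<^bsub>L'\<^esub> ra (la x m) y \<and>
        la x (ra m y) = ra (la x m) y \<ominus>\<^bsub>L'\<^esub> la (x \<otimes>\<^bsub>L\<^esub> y) m \<and>
        ra m (x \<otimes>\<^bsub>L\<^esub> y) = ra (ra m x) y \<ominus>\<^bsub>L'\<^esub> ra (ra m y) x)"

definition semidirect ::
  "('k, 'a) module \<Rightarrow> ('k, 'b) module \<Rightarrow> ('b \<Rightarrow> 'a \<Rightarrow> 'a) \<Rightarrow> ('a \<Rightarrow> 'b \<Rightarrow> 'a) \<Rightarrow> ('k, 'a \<times> 'b) module" where
  "semidirect L' L la ra = (leibniz_prod L' L)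
     \<lparr>mult := (\<lambda>(m, x) (n, y). ((m \<otimes>\<^bsub>L'\<^esub> n) \<oplus>\<^bsub>L'\<^esub> ra m y \<oplus>\<^bsub>L'\<^esub> la x n, x \<otimes>\<^bsub>L\<^esub> y))\<rparr>"

text \<open>In $(L_1,L_0,\partial)$, \<open>top_alg\<close> is $L_1$ and \<open>base_alg\<close> is $L_0$; \<open>lact\<close> and \<open>ract\<close> are the
  two maps of the action of $L_0$ on $L_1$.\<close>

record ('k, 'a, 'b) xmod =
  top_alg :: "('k, 'a) module"
  base_alg :: "('k, 'b) module"
  bdry :: "'a \<Rightarrow> 'b"
  lact :: "'b \<Rightarrow> 'a \<Rightarrow> 'a"
  ract :: "'a \<Rightarrow> 'b \<Rightarrow> 'a"

definition crossed_module :: "'k ring \<Rightarrow> ('k, 'a, 'b) xmod \<Rightarrow> bool" where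
  "crossed_module K X \<longleftrightarrow>
     leibniz_algebra K (top_alg X) \<and> leibniz_algebra K (base_alg X) \<and>
     bdry X \<in> leibniz_hom K (top_alg X) (base_alg X) \<and>
     leibniz_action K (base_alg X) (top_alg X) (lact X) (ract X) \<and>
     (\<forall>x \<in> carrier (base_alg X). \<forall>m \<in> carrier (top_alg X).
        bdry X (lact X x m) = x \<otimes>\<^bsub>base_alg X\<^esub> bdry X m \<and>
        bdry X (ract X m x) = bdry X m \<otimes>\<^bsub>base_alg X\<^esub> x) \<and>
     (\<forall>m \<in> carrier (top_alg X). \<forall>n \<in> carrier (top_alg X).
        ract X m (bdry X n) = m \<otimes>\<^bsub>top_alg X\<^esub> n \<and>
        lact X (bdry X n) m = n \<otimes>\<^bsub>top_alg X\<^esub> m)"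

definition xmod_hom ::
  "'k ring \<Rightarrow> ('k, 'a, 'b) xmod \<Rightarrow> ('k, 'c, 'd) xmod \<Rightarrow> (('a \<Rightarrow> 'c) \<times> ('b \<Rightarrow> 'd)) set" where
  "xmod_hom K X Y = {(f1, f0).
     f1 \<in> leibniz_hom K (top_alg X) (top_alg Y) \<and>
     f0 \<in> leibniz_hom K (base_alg X) (base_alg Y) \<and>
     (\<forall>m \<in> carrier (top_alg X). f0 (bdry X m) = bdry Y (f1 m)) \<and>
     (\<forall>x \<in> carrier (base_alg X). \<forall>m \<in> carrier (top_alg X).
        f1 (lact X x m) = lact Y (f0 x) (f1 m) \<and>
        f1 (ract X m x) = ract Y (f1 m) (f0 x))}"


section \<open>Internal groupoids\<close>

text \<open>\<open>comp_arr G h g\<close> is $h\circ g$; it is meaningful only when \<open>src G h = tgt G g\<close>.\<close>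

record ('k, 'm, 'o) int_groupoid =
  mor_alg :: "('k, 'm) module"
  obj_alg :: "('k, 'o) module"
  src :: "'m \<Rightarrow> 'o"
  tgt :: "'m \<Rightarrow> 'o"
  ident :: "'o \<Rightarrow> 'm"
  comp_arr :: "'m \<Rightarrow> 'm \<Rightarrow> 'm"

definition groupoid_laws :: "('k, 'm, 'o) int_groupoid \<Rightarrow> bool" where
  "groupoid_laws G \<longleftrightarrow> (let M = carrier (mor_alg G); B = carrier (obj_alg G) in
     src G \<in> M \<rightarrow> B \<and> tgt G \<in> M \<rightarrow> B \<and> ident G \<in> B \<rightarrow> M \<and>
     (\<forall>x \<in> B. src G (ident G x) = x \<and> tgt G (ident G x) = x) \<and>
     (\<forall>h \<in> M. \<forall>g \<in> M. src G h = tgt G g \<longrightarrow>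
        comp_arr G h g \<in> M \<and> src G (comp_arr G h g) = src G g \<and> tgt G (comp_arr G h g) = tgt G h) \<and>
     (\<forall>k \<in> M. \<forall>h \<in> M. \<forall>g \<in> M. src G k = tgt G h \<and> src G h = tgt G g \<longrightarrow>
        comp_arr G (comp_arr G k h) g = comp_arr G k (comp_arr G h g)) \<and>
     (\<forall>g \<in> M. comp_arr G g (ident G (src G g)) = g \<and> comp_arr G (ident G (tgt G g)) g = g) \<and>
     (\<forall>g \<in> M. \<exists>h \<in> M. src G h = tgt G g \<and> tgt G h = src G g \<and>
        comp_arr G h g = ident G (src G g) \<and> comp_arr G g h = ident G (tgt G g)))"

definition internal_groupoid :: "'k ring \<Rightarrow> ('k, 'm, 'o) int_groupoid \<Rightarrow> bool" where
  "internal_groupoid K G \<longleftrightarrow>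
     groupoid_laws G \<and>
     leibniz_algebra K (mor_alg G) \<and> leibniz_algebra K (obj_alg G) \<and>
     src G \<in> leibniz_hom K (mor_alg G) (obj_alg G) \<and>
     tgt G \<in> leibniz_hom K (mor_alg G) (obj_alg G) \<and>
     ident G \<in> leibniz_hom K (obj_alg G) (mor_alg G) \<and>
     (\<lambda>(h, g). comp_arr G h g) \<in>
        leibniz_hom K (leibniz_pullback (mor_alg G) (mor_alg G) (src G) (tgt G)) (mor_alg G)"

text \<open>A morphism of internal groupoids is the pair \<open>(f, f0)\<close> of its arrow map and its object
  map \<open>Ob(f)\<close>.\<close>

definition int_groupoid_hom ::
  "'k ring \<Rightarrow> ('k, 'm, 'o) int_groupoid \<Rightarrow> ('k, 'n, 'p) int_groupoid \<Rightarrow> (('m \<Rightarrow> 'n) \<times> ('o \<Rightarrow> 'p)) set" where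
  "int_groupoid_hom K G H = {(f, f0).
     f \<in> leibniz_hom K (mor_alg G) (mor_alg H) \<and>
     f0 \<in> leibniz_hom K (obj_alg G) (obj_alg H) \<and>
     (\<forall>g \<in> carrier (mor_alg G). src H (f g) = f0 (src G g) \<and> tgt H (f g) = f0 (tgt G g)) \<and>
     (\<forall>x \<in> carrier (obj_alg G). f (ident G x) = ident H (f0 x)) \<and>
     (\<forall>h \<in> carrier (mor_alg G). \<forall>g \<in> carrier (mor_alg G). src G h = tgt G g \<longrightarrow>
        f (comp_arr G h g) = comp_arr H (f h) (f g))}"

definition groupoid_of_xmod :: "('k, 'a, 'b) xmod \<Rightarrow> ('k, 'a \<times> 'b, 'b) int_groupoid" where
  "groupoid_of_xmod X =
    \<lparr>mor_alg = semidirect (top_alg X) (base_alg X) (lact X) (ract X),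
     obj_alg = base_alg X,
     src = (\<lambda>(m, x). x),
     tgt = (\<lambda>(m, x). bdry X m \<oplus>\<^bsub>base_alg X\<^esub> x),
     ident = (\<lambda>x. (\<zero>\<^bsub>top_alg X\<^esub>, x)),
     comp_arr = (\<lambda>(m', x') (m, x). (m' \<oplus>\<^bsub>top_alg X\<^esub> m, x))\<rparr>"


section \<open>Categories and equivalence of categories\<close>

text \<open>Hom-sets need not be disjoint, so composition and the action of a functor on arrows take
  the objects involved as arguments: \<open>Comp C a b c g f\<close> is $g\circ f$ for
  $f\colon a\to b$ and $g\colon b\to c$.\<close>

record ('o, 'm) cat =
  Obj :: "'o set"
  Hom :: "'o \<Rightarrow> 'o \<Rightarrow> 'm set"
  Id :: "'o \<Rightarrow> 'm"
  Comp :: "'o \<Rightarrow> 'o \<Rightarrow> 'o \<Rightarrow> 'm \<Rightarrow> 'm \<Rightarrow> 'm"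

locale category =
  fixes C :: "('o, 'm) cat"
  assumes Id_in: "a \<in> Obj C \<Longrightarrow> Id C a \<in> Hom C a a"
    and Comp_in: "\<lbrakk>a \<in> Obj C; b \<in> Obj C; c \<in> Obj C; f \<in> Hom C a b; g \<in> Hom C b c\<rbrakk> \<Longrightarrow>
      Comp C a b c g f \<in> Hom C a c"
    and Comp_Id_right: "\<lbrakk>a \<in> Obj C; b \<in> Obj C; f \<in> Hom C a b\<rbrakk> \<Longrightarrow> Comp C a a b f (Id C a) = f"
    and Comp_Id_left: "\<lbrakk>a \<in> Obj C; b \<in> Obj C; f \<in> Hom C a b\<rbrakk> \<Longrightarrow> Comp C a b b (Id C b) f = f"
    and Comp_assoc:
      "\<lbrakk>a \<in> Obj C; b \<in> Obj C; c \<in> Obj C; d \<in> Obj C;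
        f \<in> Hom C a b; g \<in> Hom C b c; h \<in> Hom C c d\<rbrakk> \<Longrightarrow>
      Comp C a b d (Comp C b c d h g) f = Comp C a c d h (Comp C a b c g f)"

definition isos :: "('o, 'm) cat \<Rightarrow> 'o \<Rightarrow> 'o \<Rightarrow> 'm set" where
  "isos C a b = {f \<in> Hom C a b. \<exists>g \<in> Hom C b a.
     Comp C a b a g f = Id C a \<and> Comp C b a b f g = Id C b}"

record ('o, 'm, 'p, 'n) cat_map =
  omap :: "'o \<Rightarrow> 'p"
  amap :: "'o \<Rightarrow> 'o \<Rightarrow> 'm \<Rightarrow> 'n"

definition is_functor :: "('o, 'm) cat \<Rightarrow> ('p, 'n) cat \<Rightarrow> ('o, 'm, 'p, 'n) cat_map \<Rightarrow> bool" where
  "is_functor C D F \<longleftrightarrow>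
     (\<forall>a \<in> Obj C. omap F a \<in> Obj D) \<and>
     (\<forall>a \<in> Obj C. \<forall>b \<in> Obj C. \<forall>f \<in> Hom C a b. amap F a b f \<in> Hom D (omap F a) (omap F b)) \<and>
     (\<forall>a \<in> Obj C. amap F a a (Id C a) = Id D (omap F a)) \<and>
     (\<forall>a \<in> Obj C. \<forall>b \<in> Obj C. \<forall>c \<in> Obj C. \<forall>f \<in> Hom C a b. \<forall>g \<in> Hom C b c.
        amap F a c (Comp C a b c g f) =
          Comp D (omap F a) (omap F b) (omap F c) (amap F b c g) (amap F a b f))"

definition functor_id :: "('o, 'm, 'o, 'm) cat_map" where
  "functor_id = \<lparr>omap = (\<lambda>a. a), amap = (\<lambda>a b f. f)\<rparr>"

definition functor_comp ::
  "('p, 'n, 'q, 'l) cat_map \<Rightarrow> ('o, 'm, 'p, 'n) cat_map \<Rightarrow> ('o, 'm, 'q, 'l) cat_map" where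
  "functor_comp G F =
     \<lparr>omap = (\<lambda>a. omap G (omap F a)),
      amap = (\<lambda>a b f. amap G (omap F a) (omap F b) (amap F a b f))\<rparr>"

definition natural_iso ::
  "('o, 'm) cat \<Rightarrow> ('p, 'n) cat \<Rightarrow> ('o, 'm, 'p, 'n) cat_map \<Rightarrow> ('o, 'm, 'p, 'n) cat_map \<Rightarrow>
    ('o \<Rightarrow> 'n) \<Rightarrow> bool" where
  "natural_iso C D F G \<eta> \<longleftrightarrow>
     (\<forall>a \<in> Obj C. \<eta> a \<in> isos D (omap F a) (omap G a)) \<and>
     (\<forall>a \<in> Obj C. \<forall>b \<in> Obj C. \<forall>f \<in> Hom C a b.
        Comp D (omap F a) (omap F b) (omap G b) (\<eta> b) (amap F a b f) =
        Comp D (omap F a) (omap G a) (omap G b) (amap G a b f) (\<eta> a))"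

definition equivalent_categories :: "('o, 'm) cat \<Rightarrow> ('p, 'n) cat \<Rightarrow> bool" where
  "equivalent_categories C D \<longleftrightarrow> category C \<and> category D \<and>
     (\<exists>F G \<eta> \<epsilon>. is_functor C D F \<and> is_functor D C G \<and>
        natural_iso C C functor_id (functor_comp G F) \<eta> \<and>
        natural_iso D D (functor_comp F G) functor_id \<epsilon>)"


section \<open>The two categories of coverings\<close>

text \<open>All algebras occurring in the objects of these categories have as carrier some subset of a
  type \<open>'u\<close>, which plays the role of the universe of sets; for infinite \<open>'u\<close> it is closed under
  products, because \<open>'u \<times> 'u\<close> then embeds into \<open>'u\<close>. The crossed module (or the groupoid)
  that is covered may live in other types.

  Arrows are required to be extensional, i.e. \<open>undefined\<close> outside the carriers, so that two arrows
  are equal as soon as they agree on the carriers. The maps that form part of an object are not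
  normalised in this way: objects which agree on the carriers are isomorphic by the identity.\<close>

type_synonym ('k, 'u, 'a, 'b) xmod_over =
  "('k, 'u, 'u) xmod \<times> ('u \<Rightarrow> 'a) \<times> ('u \<Rightarrow> 'b)"

type_synonym ('k, 'u, 'm, 'o) groupoid_over =
  "('k, 'u, 'u) int_groupoid \<times> ('u \<Rightarrow> 'm) \<times> ('u \<Rightarrow> 'o)"

type_synonym 'u map_pair = "('u \<Rightarrow> 'u) \<times> ('u \<Rightarrow> 'u)"

definition xmod_covering ::
  "'k ring \<Rightarrow> ('k, 'a, 'b) xmod \<Rightarrow> ('k, 'c, 'd) xmod \<Rightarrow> ('c \<Rightarrow> 'a) \<times> ('d \<Rightarrow> 'b) \<Rightarrow> bool" where
  "xmod_covering K X Y p \<longleftrightarrow>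
     crossed_module K Y \<and> p \<in> xmod_hom K Y X \<and> fst p \<in> leibniz_iso K (top_alg Y) (top_alg X)"

definition Cov_XMod ::
  "'k ring \<Rightarrow> ('k, 'a, 'b) xmod \<Rightarrow> (('k, 'u, 'a, 'b) xmod_over, 'u map_pair) cat" where
  "Cov_XMod K X =
    \<lparr>Obj = {(Y, p). xmod_covering K X Y p},
     Hom = (\<lambda>(Y, (p1, p0)) (Z, (q1, q0)). {(f1, f0) \<in> xmod_hom K Y Z.
        f1 \<in> extensional (carrier (top_alg Y)) \<and> f0 \<in> extensional (carrier (base_alg Y)) \<and>
        (\<forall>m \<in> carrier (top_alg Y). q1 (f1 m) = p1 m) \<and>
        (\<forall>x \<in> carrier (base_alg Y). q0 (f0 x) = p0 x)}),
     Id = (\<lambda>(Y, p). (restrict id (carrier (top_alg Y)), restrict id (carrier (base_alg Y)))),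
     Comp = (\<lambda>(Y, p) _ _ (g1, g0) (f1, f0).
        (compose (carrier (top_alg Y)) g1 f1, compose (carrier (base_alg Y)) g0 f0))\<rparr>"

definition groupoid_covering ::
  "'k ring \<Rightarrow> ('k, 'm, 'o) int_groupoid \<Rightarrow> ('k, 'n, 'p) int_groupoid \<Rightarrow>
    ('n \<Rightarrow> 'm) \<times> ('p \<Rightarrow> 'o) \<Rightarrow> bool" where
  "groupoid_covering K G H p \<longleftrightarrow>
     internal_groupoid K H \<and> p \<in> int_groupoid_hom K H G \<and>
     (\<lambda>h. (fst p h, src H h)) \<in>
        leibniz_iso K (mor_alg H) (leibniz_pullback (mor_alg G) (obj_alg H) (src G) (snd p))"

definition Cov_Grpd ::
  "'k ring \<Rightarrow> ('k, 'm, 'o) int_groupoid \<Rightarrow> (('k, 'u, 'm, 'o) groupoid_over, 'u map_pair) cat" where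
  "Cov_Grpd K G =
    \<lparr>Obj = {(H, p). groupoid_covering K G H p},
     Hom = (\<lambda>(H, (p, p0)) (J, (q, q0)). {(f, f0) \<in> int_groupoid_hom K H J.
        f \<in> extensional (carrier (mor_alg H)) \<and> f0 \<in> extensional (carrier (obj_alg H)) \<and>
        (\<forall>h \<in> carrier (mor_alg H). q (f h) = p h) \<and>
        (\<forall>x \<in> carrier (obj_alg H). q0 (f0 x) = p0 x)}),
     Id = (\<lambda>(H, p). (restrict id (carrier (mor_alg H)), restrict id (carrier (obj_alg H)))),
     Comp = (\<lambda>(H, p) _ _ (g, g0) (f, f0).
        (compose (carrier (mor_alg H)) g f, compose (carrier (obj_alg H)) g0 f0))\<rparr>"

end

(* Every arrow h of an internal groupoid H in Lbnz is uniquely m + eps(x) with d_0(m) = 0 and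
   x = d_0(h). Linearity of the composition forces h o g = h - eps(d_0(h)) + g and makes the
   bracket of ker d_0 with ker d_1 vanish, which is the Peiffer identity; hence
   (ker d_0, Ob(H), d_1) is a crossed module whose groupoid is isomorphic to H. Consequently
   Y |-> groupoid of Y is fully faithful and essentially surjective on coverings. On coverings the
   condition "(p, d_0) is an isomorphism" says exactly that p restricts to an isomorphism
   ker d_0 -> L_1. The arrows of the groupoid of Y are pairs; they are brought back into the
   universe 'u along an injection 'u * 'u -> 'u. *)

theory Submission
  imports Defs
begin

section \<open>Bilinear maps and homomorphisms\<close>

lemma (in abelian_group) eq_minus_iff:
  assumes "a \<in> carrier G" "b \<in> carrier G" "c \<in> carrier G"
  shows "a = b \<ominus> c \<longleftrightarrow> a \<oplus> c = b"
  using assms by (metis a_closed a_inv_closed a_assoc minus_eq r_neg l_neg r_zero)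

lemma bilinear_mapD:
  assumes "bilinear_map K U V W \<beta>"
  shows "\<lbrakk>u \<in> carrier U; v \<in> carrier V\<rbrakk> \<Longrightarrow> \<beta> u v \<in> carrier W"
    and "\<lbrakk>u \<in> carrier U; u' \<in> carrier U; v \<in> carrier V\<rbrakk> \<Longrightarrow>
      \<beta> (u \<oplus>\<^bsub>U\<^esub> u') v = \<beta> u v \<oplus>\<^bsub>W\<^esub> \<beta> u' v"
    and "\<lbrakk>u \<in> carrier U; v \<in> carrier V; v' \<in> carrier V\<rbrakk> \<Longrightarrow>
      \<beta> u (v \<oplus>\<^bsub>V\<^esub> v') = \<beta> u v \<oplus>\<^bsub>W\<^esub> \<beta> u v'"
    and "\<lbrakk>c \<in> carrier K; u \<in> carrier U; v \<in> carrier V\<rbrakk> \<Longrightarrow>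
      \<beta> (c \<odot>\<^bsub>U\<^esub> u) v = c \<odot>\<^bsub>W\<^esub> \<beta> u v"
    and "\<lbrakk>c \<in> carrier K; u \<in> carrier U; v \<in> carrier V\<rbrakk> \<Longrightarrow>
      \<beta> u (c \<odot>\<^bsub>V\<^esub> v) = c \<odot>\<^bsub>W\<^esub> \<beta> u v"
  using assms unfolding bilinear_map_def by blast+

lemma bilinear_map_zero:
  assumes "bilinear_map K U V W \<beta>" "abelian_group U" "abelian_group V" "abelian_group W"
  shows "v \<in> carrier V \<Longrightarrow> \<beta> \<zero>\<^bsub>U\<^esub> v = \<zero>\<^bsub>W\<^esub>"
    and "u \<in> carrier U \<Longrightarrow> \<beta> u \<zero>\<^bsub>V\<^esub> = \<zero>\<^bsub>W\<^esub>"
proof -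
  interpret U: abelian_group U by fact
  interpret V: abelian_group V by fact
  interpret W: abelian_group W by fact
  note b = bilinear_mapD[OF assms(1)]
  show "\<beta> \<zero>\<^bsub>U\<^esub> v = \<zero>\<^bsub>W\<^esub>" if "v \<in> carrier V"
    using b(2)[of "\<zero>\<^bsub>U\<^esub>" "\<zero>\<^bsub>U\<^esub>" v] b(1)[of "\<zero>\<^bsub>U\<^esub>" v] that
    by (simp add: W.add.r_cancel_one')
  show "\<beta> u \<zero>\<^bsub>V\<^esub> = \<zero>\<^bsub>W\<^esub>" if "u \<in> carrier U"
    using b(3)[of u "\<zero>\<^bsub>V\<^esub>" "\<zero>\<^bsub>V\<^esub>"] b(1)[of u "\<zero>\<^bsub>V\<^esub>"] that
    by (simp add: W.add.r_cancel_one')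
qed

context leibniz_algebra
begin

lemmas bracket_closed [simp, intro] = bilinear_mapD(1)[OF bracket_bilinear]
lemmas bracket_add_left = bilinear_mapD(2)[OF bracket_bilinear]
lemmas bracket_add_right = bilinear_mapD(3)[OF bracket_bilinear]
lemmas bracket_smult_left = bilinear_mapD(4)[OF bracket_bilinear]
lemmas bracket_smult_right = bilinear_mapD(5)[OF bracket_bilinear]
lemmas bracket_zero_left [simp] =
  bilinear_map_zero(1)[OF bracket_bilinear abelian_group_axioms abelian_group_axioms abelian_group_axioms]
lemmas bracket_zero_right [simp] =
  bilinear_map_zero(2)[OF bracket_bilinear abelian_group_axioms abelian_group_axioms abelian_group_axioms]

lemma leibniz_identity_add:
  "\<lbrakk>x \<in> carrier L; y \<in> carrier L; z \<in> carrier L\<rbrakk> \<Longrightarrow>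
    x \<otimes>\<^bsub>L\<^esub> (y \<otimes>\<^bsub>L\<^esub> z) \<oplus>\<^bsub>L\<^esub> (x \<otimes>\<^bsub>L\<^esub> z) \<otimes>\<^bsub>L\<^esub> y = (x \<otimes>\<^bsub>L\<^esub> y) \<otimes>\<^bsub>L\<^esub> z"
  using leibniz_identity[of x y z] by (simp add: M.eq_minus_iff)

end

lemma leibniz_algebraI:
  assumes "field K" "module K L" "bilinear_map K L L L (\<lambda>x y. x \<otimes>\<^bsub>L\<^esub> y)"
    and "\<And>x y z. \<lbrakk>x \<in> carrier L; y \<in> carrier L; z \<in> carrier L\<rbrakk> \<Longrightarrow>
      x \<otimes>\<^bsub>L\<^esub> (y \<otimes>\<^bsub>L\<^esub> z) \<oplus>\<^bsub>L\<^esub> (x \<otimes>\<^bsub>L\<^esub> z) \<otimes>\<^bsub>L\<^esub> y = (x \<otimes>\<^bsub>L\<^esub> y) \<otimes>\<^bsub>L\<^esub> z"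
  shows "leibniz_algebra K L"
proof -
  interpret M: module K L by fact
  have "leibniz_algebra_axioms K L"
    by unfold_locales (use assms(3,4) in \<open>simp_all add: M.eq_minus_iff bilinear_mapD(1)[OF assms(3)]\<close>)
  then show ?thesis
    using assms(1,2) by (simp add: leibniz_algebra_def)
qed

lemma leibniz_homI:
  assumes "\<And>x. x \<in> carrier L \<Longrightarrow> f x \<in> carrier M"
    and "\<And>x y. \<lbrakk>x \<in> carrier L; y \<in> carrier L\<rbrakk> \<Longrightarrow> f (x \<oplus>\<^bsub>L\<^esub> y) = f x \<oplus>\<^bsub>M\<^esub> f y"
    and "\<And>c x. \<lbrakk>c \<in> carrier K; x \<in> carrier L\<rbrakk> \<Longrightarrow> f (c \<odot>\<^bsub>L\<^esub> x) = c \<odot>\<^bsub>M\<^esub> f x"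
    and "\<And>x y. \<lbrakk>x \<in> carrier L; y \<in> carrier L\<rbrakk> \<Longrightarrow> f (x \<otimes>\<^bsub>L\<^esub> y) = f x \<otimes>\<^bsub>M\<^esub> f y"
  shows "f \<in> leibniz_hom K L M"
  using assms by (simp add: leibniz_hom_def)

lemma leibniz_homD:
  assumes "f \<in> leibniz_hom K L M"
  shows "x \<in> carrier L \<Longrightarrow> f x \<in> carrier M"
    and "\<lbrakk>x \<in> carrier L; y \<in> carrier L\<rbrakk> \<Longrightarrow> f (x \<oplus>\<^bsub>L\<^esub> y) = f x \<oplus>\<^bsub>M\<^esub> f y"
    and "\<lbrakk>c \<in> carrier K; x \<in> carrier L\<rbrakk> \<Longrightarrow> f (c \<odot>\<^bsub>L\<^esub> x) = c \<odot>\<^bsub>M\<^esub> f x"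
    and "\<lbrakk>x \<in> carrier L; y \<in> carrier L\<rbrakk> \<Longrightarrow> f (x \<otimes>\<^bsub>L\<^esub> y) = f x \<otimes>\<^bsub>M\<^esub> f y"
  using assms by (auto simp: leibniz_hom_def)

lemma leibniz_hom_zero:
  assumes "f \<in> leibniz_hom K L M" "abelian_group L" "abelian_group M"
  shows "f \<zero>\<^bsub>L\<^esub> = \<zero>\<^bsub>M\<^esub>"
proof -
  interpret L: abelian_group L by fact
  interpret M: abelian_group M by fact
  show ?thesis
    using leibniz_homD(2)[OF assms(1), of "\<zero>\<^bsub>L\<^esub>" "\<zero>\<^bsub>L\<^esub>"] leibniz_homD(1)[OF assms(1), of "\<zero>\<^bsub>L\<^esub>"]
    by (simp add: M.add.r_cancel_one')
qed

lemma leibniz_hom_inv: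
  assumes "f \<in> leibniz_hom K L M" "abelian_group L" "abelian_group M" "x \<in> carrier L"
  shows "f (\<ominus>\<^bsub>L\<^esub> x) = \<ominus>\<^bsub>M\<^esub> f x"
proof -
  interpret L: abelian_group L by fact
  interpret M: abelian_group M by fact
  have "f (\<ominus>\<^bsub>L\<^esub> x) \<oplus>\<^bsub>M\<^esub> f x = \<zero>\<^bsub>M\<^esub>"
    using leibniz_homD(2)[OF assms(1), of "\<ominus>\<^bsub>L\<^esub> x" x] leibniz_hom_zero[OF assms(1-3)] assms(4)
    by (simp add: L.l_neg)
  then show ?thesis
    using leibniz_homD(1)[OF assms(1)] assms(4) by (metis L.a_inv_closed M.minus_equality)
qed

lemma leibniz_hom_cong:
  assumes "f \<in> leibniz_hom K L M" "leibniz_algebra K L" "\<And>x. x \<in> carrier L \<Longrightarrow> g x = f x"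
  shows "g \<in> leibniz_hom K L M"
proof -
  interpret L: leibniz_algebra K L by fact
  show ?thesis
    by (rule leibniz_homI) (use assms(3) in \<open>simp_all add: leibniz_homD[OF assms(1)]\<close>)
qed

lemma leibniz_hom_comp:
  assumes "f \<in> leibniz_hom K L M" "g \<in> leibniz_hom K M N"
  shows "(\<lambda>x. g (f x)) \<in> leibniz_hom K L N"
  by (rule leibniz_homI) (simp_all add: leibniz_homD[OF assms(1)] leibniz_homD[OF assms(2)])

lemma inv_into_leibniz_hom:
  assumes "f \<in> leibniz_hom K L M" "bij_betw f (carrier L) (carrier M)" "leibniz_algebra K L"
  shows "inv_into (carrier L) f \<in> leibniz_hom K M L"
proof -
  interpret L: leibniz_algebra K L by fact
  let ?g = "inv_into (carrier L) f"
  have gf: "?g (f x) = x" if "x \<in> carrier L" for x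
    using assms(2) that by (simp add: bij_betw_inv_into_left)
  have surj: "carrier M = f ` carrier L"
    using assms(2) by (simp add: bij_betw_imp_surj_on)
  show ?thesis
    by (rule leibniz_homI)
      (auto simp: surj gf simp flip: leibniz_homD(2-4)[OF assms(1)])
qed

lemma leibniz_isoI:
  assumes "f \<in> leibniz_hom K L M" "bij_betw f (carrier L) (carrier M)" "leibniz_algebra K L"
  shows "f \<in> leibniz_iso K L M"
  unfolding leibniz_iso_def
  using assms(1) inv_into_leibniz_hom[OF assms] assms(2)
  by (auto simp: bij_betw_inv_into_left bij_betw_inv_into_right
      intro!: bexI[where x = "inv_into (carrier L) f"])

lemma leibniz_isoD:
  assumes "f \<in> leibniz_iso K L M"
  shows "f \<in> leibniz_hom K L M" "bij_betw f (carrier L) (carrier M)"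
proof -
  show f: "f \<in> leibniz_hom K L M"
    using assms by (simp add: leibniz_iso_def)
  obtain g where "g \<in> leibniz_hom K M L" "\<forall>x \<in> carrier L. g (f x) = x" "\<forall>y \<in> carrier M. f (g y) = y"
    using assms by (auto simp: leibniz_iso_def)
  then show "bij_betw f (carrier L) (carrier M)"
    by (intro bij_betw_byWitness[where f' = g]) (auto dest: leibniz_homD(1) leibniz_homD(1)[OF f])
qed

section \<open>Constructions of Leibniz algebras\<close>

text \<open>Only surjectivity is needed: all axioms are equational, apart from the existence of
  negatives.\<close>

lemma leibniz_algebra_hom_image:
  assumes L: "leibniz_algebra K L" and f: "f \<in> leibniz_hom K L M"
    and surj: "carrier M = f ` carrier L" and zero: "\<zero>\<^bsub>M\<^esub> = f \<zero>\<^bsub>L\<^esub>"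
  shows "leibniz_algebra K M"
proof -
  interpret L: leibniz_algebra K L by fact
  note f_simps = surj zero leibniz_homD(2-4)[OF f, symmetric]
  have "abelian_group M"
    by (rule abelian_groupI)
      (auto simp: f_simps L.M.a_ac L.M.r_neg intro!: bexI[where x = "\<ominus>\<^bsub>L\<^esub> x" for x])
  then have "module K M"
    by (intro moduleI L.is_cring)
      (auto simp: f_simps L.smult_l_distr L.smult_r_distr L.smult_assoc1)
  moreover have "bilinear_map K M M M (\<lambda>x y. x \<otimes>\<^bsub>M\<^esub> y)"
    unfolding bilinear_map_def
    by (auto simp: f_simps L.bracket_add_left L.bracket_add_right L.bracket_smult_left
        L.bracket_smult_right)
  ultimately show ?thesis
    by (intro leibniz_algebraI L.field_axioms) (auto simp: f_simps L.leibniz_identity_add)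
qed

lemma leibniz_subalgebra:
  assumes L: "leibniz_algebra K L" and "S \<subseteq> carrier L" "\<zero>\<^bsub>L\<^esub> \<in> S"
    and cl: "\<And>x y. \<lbrakk>x \<in> S; y \<in> S\<rbrakk> \<Longrightarrow> x \<oplus>\<^bsub>L\<^esub> y \<in> S"
      "\<And>c x. \<lbrakk>c \<in> carrier K; x \<in> S\<rbrakk> \<Longrightarrow> c \<odot>\<^bsub>L\<^esub> x \<in> S"
      "\<And>x y. \<lbrakk>x \<in> S; y \<in> S\<rbrakk> \<Longrightarrow> x \<otimes>\<^bsub>L\<^esub> y \<in> S"
  shows "leibniz_algebra K (L\<lparr>carrier := S\<rparr>)"
proof -
  interpret L: leibniz_algebra K L by fact
  have S: "x \<in> carrier L" if "x \<in> S" for x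
    using that assms(2) by blast
  have "abelian_group (L\<lparr>carrier := S\<rparr>)"
  proof (rule abelian_groupI; simp)
    fix x assume x: "x \<in> S"
    have "\<ominus>\<^bsub>L\<^esub> x = (\<ominus>\<^bsub>K\<^esub> \<one>\<^bsub>K\<^esub>) \<odot>\<^bsub>L\<^esub> x"
      using x S by (simp add: L.smult_l_minus)
    then have "\<ominus>\<^bsub>L\<^esub> x \<in> S"
      using cl(2)[of "\<ominus>\<^bsub>K\<^esub> \<one>\<^bsub>K\<^esub>" x] x by simp
    then show "\<exists>y\<in>S. y \<oplus>\<^bsub>L\<^esub> x = \<zero>\<^bsub>L\<^esub>"
      using x S L.M.l_neg by blast
  qed (use assms(3) in \<open>simp_all add: S L.M.a_ac cl\<close>)
  then have "module K (L\<lparr>carrier := S\<rparr>)"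
    by (intro moduleI L.is_cring)
      (auto simp: S cl L.smult_l_distr L.smult_r_distr L.smult_assoc1)
  moreover have "bilinear_map K (L\<lparr>carrier := S\<rparr>) (L\<lparr>carrier := S\<rparr>) (L\<lparr>carrier := S\<rparr>)
      (\<lambda>x y. x \<otimes>\<^bsub>L\<lparr>carrier := S\<rparr>\<^esub> y)"
    unfolding bilinear_map_def
    by (auto simp: S cl L.bracket_add_left L.bracket_add_right L.bracket_smult_left
        L.bracket_smult_right)
  ultimately show ?thesis
    by (intro leibniz_algebraI L.field_axioms) (auto simp: S L.leibniz_identity_add)
qed

lemma leibniz_pullback_simps [simp]:
  "carrier (leibniz_pullback L M f g) = {(x, y). x \<in> carrier L \<and> y \<in> carrier M \<and> f x = g y}"
  "\<zero>\<^bsub>leibniz_pullback L M f g\<^esub> = (\<zero>\<^bsub>L\<^esub>, \<zero>\<^bsub>M\<^esub>)"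
  "(x, y) \<oplus>\<^bsub>leibniz_pullback L M f g\<^esub> (x', y') = (x \<oplus>\<^bsub>L\<^esub> x', y \<oplus>\<^bsub>M\<^esub> y')"
  "(x, y) \<otimes>\<^bsub>leibniz_pullback L M f g\<^esub> (x', y') = (x \<otimes>\<^bsub>L\<^esub> x', y \<otimes>\<^bsub>M\<^esub> y')"
  "c \<odot>\<^bsub>leibniz_pullback L M f g\<^esub> (x, y) = (c \<odot>\<^bsub>L\<^esub> x, c \<odot>\<^bsub>M\<^esub> y)"
  by (simp_all add: leibniz_pullback_def leibniz_prod_def)

lemma semidirect_simps [simp]:
  "carrier (semidirect L' L la ra) = carrier L' \<times> carrier L"
  "\<zero>\<^bsub>semidirect L' L la ra\<^esub> = (\<zero>\<^bsub>L'\<^esub>, \<zero>\<^bsub>L\<^esub>)"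
  "(m, x) \<oplus>\<^bsub>semidirect L' L la ra\<^esub> (n, y) = (m \<oplus>\<^bsub>L'\<^esub> n, x \<oplus>\<^bsub>L\<^esub> y)"
  "(m, x) \<otimes>\<^bsub>semidirect L' L la ra\<^esub> (n, y) = (m \<otimes>\<^bsub>L'\<^esub> n \<oplus>\<^bsub>L'\<^esub> ra m y \<oplus>\<^bsub>L'\<^esub> la x n, x \<otimes>\<^bsub>L\<^esub> y)"
  "c \<odot>\<^bsub>semidirect L' L la ra\<^esub> (m, x) = (c \<odot>\<^bsub>L'\<^esub> m, c \<odot>\<^bsub>L\<^esub> x)"
  by (simp_all add: semidirect_def leibniz_prod_def)

lemma leibniz_actionD:
  assumes "leibniz_action K L L' la ra"
  shows "bilinear_map K L L' L' la" "bilinear_map K L' L L' ra"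
    and "\<lbrakk>x \<in> carrier L; m \<in> carrier L'; n \<in> carrier L'\<rbrakk> \<Longrightarrow>
        la x (m \<otimes>\<^bsub>L'\<^esub> n) = (la x m \<otimes>\<^bsub>L'\<^esub> n) \<ominus>\<^bsub>L'\<^esub> (la x n \<otimes>\<^bsub>L'\<^esub> m)"
    and "\<lbrakk>x \<in> carrier L; m \<in> carrier L'; n \<in> carrier L'\<rbrakk> \<Longrightarrow>
        m \<otimes>\<^bsub>L'\<^esub> la x n = (ra m x \<otimes>\<^bsub>L'\<^esub> n) \<ominus>\<^bsub>L'\<^esub> ra (m \<otimes>\<^bsub>L'\<^esub> n) x"
    and "\<lbrakk>x \<in> carrier L; m \<in> carrier L'; n \<in> carrier L'\<rbrakk> \<Longrightarrow>
        m \<otimes>\<^bsub>L'\<^esub> ra n x = ra (m \<otimes>\<^bsub>L'\<^esub> n) x \<ominus>\<^bsub>L'\<^esub> (ra m x \<otimes>\<^bsub>L'\<^esub> n)"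
    and "\<lbrakk>x \<in> carrier L; y \<in> carrier L; m \<in> carrier L'\<rbrakk> \<Longrightarrow>
        la x (la y m) = la (x \<otimes>\<^bsub>L\<^esub> y) m \<ominus>\<^bsub>L'\<^esub> ra (la x m) y"
    and "\<lbrakk>x \<in> carrier L; y \<in> carrier L; m \<in> carrier L'\<rbrakk> \<Longrightarrow>
        la x (ra m y) = ra (la x m) y \<ominus>\<^bsub>L'\<^esub> la (x \<otimes>\<^bsub>L\<^esub> y) m"
    and "\<lbrakk>x \<in> carrier L; y \<in> carrier L; m \<in> carrier L'\<rbrakk> \<Longrightarrow>
        ra m (x \<otimes>\<^bsub>L\<^esub> y) = ra (ra m x) y \<ominus>\<^bsub>L'\<^esub> ra (ra m y) x"
  using assms unfolding leibniz_action_def by blast+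

lemma semidirect_leibniz_algebra:
  assumes L: "leibniz_algebra K L" and L': "leibniz_algebra K L'"
    and act: "leibniz_action K L L' la ra"
  shows "leibniz_algebra K (semidirect L' L la ra)" (is "leibniz_algebra K ?S")
proof -
  interpret L: leibniz_algebra K L by fact
  interpret L': leibniz_algebra K L' by fact
  note act_bilin = bilinear_mapD[OF leibniz_actionD(1)[OF act]] bilinear_mapD[OF leibniz_actionD(2)[OF act]]
  have "abelian_group ?S"
    by (rule abelian_groupI) (auto simp: L.M.a_ac L'.M.a_ac intro: L.M.l_neg L'.M.l_neg)
  then have "module K ?S"
    by (intro moduleI L.is_cring)
      (auto simp: L.smult_l_distr L.smult_r_distr L.smult_assoc1
        L'.smult_l_distr L'.smult_r_distr L'.smult_assoc1)
  moreover have "bilinear_map K ?S ?S ?S (\<lambda>x y. x \<otimes>\<^bsub>?S\<^esub> y)"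
    unfolding bilinear_map_def
    by (auto simp: L.bracket_add_left L.bracket_add_right L.bracket_smult_left
        L.bracket_smult_right L'.bracket_add_left L'.bracket_add_right L'.bracket_smult_left
        L'.bracket_smult_right act_bilin L'.M.a_ac L'.smult_r_distr)
  moreover have "u \<otimes>\<^bsub>?S\<^esub> (v \<otimes>\<^bsub>?S\<^esub> w) \<oplus>\<^bsub>?S\<^esub> (u \<otimes>\<^bsub>?S\<^esub> w) \<otimes>\<^bsub>?S\<^esub> v = (u \<otimes>\<^bsub>?S\<^esub> v) \<otimes>\<^bsub>?S\<^esub> w"
    if "u \<in> carrier ?S" "v \<in> carrier ?S" "w \<in> carrier ?S" for u v w
  proof -
    obtain m x n y k z where u: "u = (m, x)" "v = (n, y)" "w = (k, z)"
      by (metis surj_pair)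
    with that have c [simp]: "m \<in> carrier L'" "n \<in> carrier L'" "k \<in> carrier L'"
        "x \<in> carrier L" "y \<in> carrier L" "z \<in> carrier L"
      by auto
    have add: "m \<otimes>\<^bsub>L'\<^esub> (n \<otimes>\<^bsub>L'\<^esub> k) \<oplus>\<^bsub>L'\<^esub> (m \<otimes>\<^bsub>L'\<^esub> k) \<otimes>\<^bsub>L'\<^esub> n = (m \<otimes>\<^bsub>L'\<^esub> n) \<otimes>\<^bsub>L'\<^esub> k"
      "m \<otimes>\<^bsub>L'\<^esub> ra n z \<oplus>\<^bsub>L'\<^esub> ra m z \<otimes>\<^bsub>L'\<^esub> n = ra (m \<otimes>\<^bsub>L'\<^esub> n) z"
      "m \<otimes>\<^bsub>L'\<^esub> la y k \<oplus>\<^bsub>L'\<^esub> ra (m \<otimes>\<^bsub>L'\<^esub> k) y = ra m y \<otimes>\<^bsub>L'\<^esub> k"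
      "ra m (y \<otimes>\<^bsub>L\<^esub> z) \<oplus>\<^bsub>L'\<^esub> ra (ra m z) y = ra (ra m y) z"
      "la x (n \<otimes>\<^bsub>L'\<^esub> k) \<oplus>\<^bsub>L'\<^esub> la x k \<otimes>\<^bsub>L'\<^esub> n = la x n \<otimes>\<^bsub>L'\<^esub> k"
      "la x (ra n z) \<oplus>\<^bsub>L'\<^esub> la (x \<otimes>\<^bsub>L\<^esub> z) n = ra (la x n) z"
      "la x (la y k) \<oplus>\<^bsub>L'\<^esub> ra (la x k) y = la (x \<otimes>\<^bsub>L\<^esub> y) k"
      using leibniz_actionD(3-8)[OF act]
      by (simp_all add: act_bilin L'.leibniz_identity_add flip: L'.M.eq_minus_iff)
    show ?thesis
      unfolding u
      by (simp add: L.leibniz_identity_add L'.bracket_add_left L'.bracket_add_right act_bilin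
          add[symmetric] L'.M.a_ac)
  qed
  ultimately show ?thesis
    by (intro leibniz_algebraI L.field_axioms)
qed

section \<open>The internal groupoid of a crossed module\<close>

lemma crossed_moduleD:
  assumes "crossed_module K X"
  shows "leibniz_algebra K (top_alg X)" "leibniz_algebra K (base_alg X)"
    and "bdry X \<in> leibniz_hom K (top_alg X) (base_alg X)"
    and "leibniz_action K (base_alg X) (top_alg X) (lact X) (ract X)"
    and "\<lbrakk>x \<in> carrier (base_alg X); m \<in> carrier (top_alg X)\<rbrakk> \<Longrightarrow>
        bdry X (lact X x m) = x \<otimes>\<^bsub>base_alg X\<^esub> bdry X m"
    and "\<lbrakk>x \<in> carrier (base_alg X); m \<in> carrier (top_alg X)\<rbrakk> \<Longrightarrow>
        bdry X (ract X m x) = bdry X m \<otimes>\<^bsub>base_alg X\<^esub> x"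
    and "\<lbrakk>m \<in> carrier (top_alg X); n \<in> carrier (top_alg X)\<rbrakk> \<Longrightarrow>
        ract X m (bdry X n) = m \<otimes>\<^bsub>top_alg X\<^esub> n"
    and "\<lbrakk>m \<in> carrier (top_alg X); n \<in> carrier (top_alg X)\<rbrakk> \<Longrightarrow>
        lact X (bdry X n) m = n \<otimes>\<^bsub>top_alg X\<^esub> m"
  using assms by (simp_all add: crossed_module_def)

locale xmodule =
  fixes K :: "'k ring" and X :: "('k, 'a, 'b) xmod"
  assumes crossed_module: "crossed_module K X"

sublocale xmodule \<subseteq> top: leibniz_algebra K "top_alg X"
  using crossed_moduleD(1)[OF crossed_module] .

sublocale xmodule \<subseteq> base: leibniz_algebra K "base_alg X"
  using crossed_moduleD(2)[OF crossed_module] .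

context xmodule
begin

lemmas bdry_hom = crossed_moduleD(3)[OF crossed_module]
lemmas bdry_closed [simp] = leibniz_homD(1)[OF bdry_hom]
lemmas bdry_simps = leibniz_homD(2-4)[OF bdry_hom] crossed_moduleD(5,6)[OF crossed_module]
lemmas bdry_zero [simp] = leibniz_hom_zero[OF bdry_hom top.abelian_group_axioms base.abelian_group_axioms]
lemmas bdry_inv = leibniz_hom_inv[OF bdry_hom top.abelian_group_axioms base.abelian_group_axioms]
lemmas action = crossed_moduleD(4)[OF crossed_module]
lemmas lact_bilinear = leibniz_actionD(1)[OF action]
lemmas ract_bilinear = leibniz_actionD(2)[OF action]
lemmas lact_closed [simp] = bilinear_mapD(1)[OF lact_bilinear]
lemmas ract_closed [simp] = bilinear_mapD(1)[OF ract_bilinear]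
lemmas act_simps = bilinear_mapD(2-5)[OF lact_bilinear] bilinear_mapD(2-5)[OF ract_bilinear]
lemmas lact_zero [simp] = bilinear_map_zero[OF lact_bilinear base.abelian_group_axioms
    top.abelian_group_axioms top.abelian_group_axioms]
lemmas ract_zero [simp] = bilinear_map_zero[OF ract_bilinear top.abelian_group_axioms
    base.abelian_group_axioms top.abelian_group_axioms]
lemmas peiffer = crossed_moduleD(7,8)[OF crossed_module]

end

lemma groupoid_of_xmod_simps [simp]:
  "mor_alg (groupoid_of_xmod X) = semidirect (top_alg X) (base_alg X) (lact X) (ract X)"
  "obj_alg (groupoid_of_xmod X) = base_alg X"
  "src (groupoid_of_xmod X) = snd"
  "tgt (groupoid_of_xmod X) (m, x) = bdry X m \<oplus>\<^bsub>base_alg X\<^esub> x"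
  "ident (groupoid_of_xmod X) x = (\<zero>\<^bsub>top_alg X\<^esub>, x)"
  "comp_arr (groupoid_of_xmod X) (m', x') (m, x) = (m' \<oplus>\<^bsub>top_alg X\<^esub> m, x)"
  by (auto simp: groupoid_of_xmod_def)

lemma internal_groupoidD:
  assumes "internal_groupoid K G"
  shows "groupoid_laws G" "leibniz_algebra K (mor_alg G)" "leibniz_algebra K (obj_alg G)"
    and "src G \<in> leibniz_hom K (mor_alg G) (obj_alg G)"
    and "tgt G \<in> leibniz_hom K (mor_alg G) (obj_alg G)"
    and "ident G \<in> leibniz_hom K (obj_alg G) (mor_alg G)"
    and "(\<lambda>(h, g). comp_arr G h g) \<in>
        leibniz_hom K (leibniz_pullback (mor_alg G) (mor_alg G) (src G) (tgt G)) (mor_alg G)"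
  using assms unfolding internal_groupoid_def by auto

lemma (in xmodule) internal_groupoid_of_xmod: "internal_groupoid K (groupoid_of_xmod X)"
  (is "internal_groupoid K ?G")
proof -
  have "groupoid_laws ?G"
  proof -
    have "\<exists>h \<in> carrier (mor_alg ?G). src ?G h = tgt ?G g \<and> tgt ?G h = src ?G g \<and>
        comp_arr ?G h g = ident ?G (src ?G g) \<and> comp_arr ?G g h = ident ?G (tgt ?G g)"
      if g_in: "g \<in> carrier (mor_alg ?G)" for g
    proof -
      obtain m x where g: "g = (m, x)" "m \<in> carrier (top_alg X)" "x \<in> carrier (base_alg X)"
        using g_in by auto
      then show ?thesis
        by (intro bexI[where x = "(\<ominus>\<^bsub>top_alg X\<^esub> m, bdry X m \<oplus>\<^bsub>base_alg X\<^esub> x)"])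
          (auto simp: bdry_inv base.M.r_neg1 base.M.r_neg2 top.M.l_neg top.M.r_neg)
    qed
    then show ?thesis
      unfolding groupoid_laws_def Let_def
      by (auto simp: bdry_simps base.M.a_assoc top.M.a_assoc)
  qed
  moreover have "snd \<in> leibniz_hom K (mor_alg ?G) (base_alg X)"
    by (rule leibniz_homI) auto
  moreover have "tgt ?G \<in> leibniz_hom K (mor_alg ?G) (base_alg X)"
    by (rule leibniz_homI)
      (auto simp: bdry_simps base.M.a_ac base.smult_r_distr base.bracket_add_left base.bracket_add_right)
  moreover have "ident ?G \<in> leibniz_hom K (base_alg X) (mor_alg ?G)"
    by (rule leibniz_homI) auto
  moreover have "(\<lambda>(h, g). comp_arr ?G h g) \<in>
      leibniz_hom K (leibniz_pullback (mor_alg ?G) (mor_alg ?G) snd (tgt ?G)) (mor_alg ?G)"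
    by (rule leibniz_homI)
      (auto simp: top.M.a_ac top.smult_r_distr act_simps peiffer top.bracket_add_left top.bracket_add_right)
  moreover have "leibniz_algebra K (mor_alg ?G)"
    using semidirect_leibniz_algebra action top.leibniz_algebra_axioms base.leibniz_algebra_axioms by simp
  ultimately show ?thesis
    unfolding internal_groupoid_def using base.leibniz_algebra_axioms by simp
qed

lemma xmod_homD:
  assumes "(f1, f0) \<in> xmod_hom K X Y"
  shows "f1 \<in> leibniz_hom K (top_alg X) (top_alg Y)" "f0 \<in> leibniz_hom K (base_alg X) (base_alg Y)"
    and "m \<in> carrier (top_alg X) \<Longrightarrow> f0 (bdry X m) = bdry Y (f1 m)"
    and "\<lbrakk>x \<in> carrier (base_alg X); m \<in> carrier (top_alg X)\<rbrakk> \<Longrightarrow>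
        f1 (lact X x m) = lact Y (f0 x) (f1 m)"
    and "\<lbrakk>x \<in> carrier (base_alg X); m \<in> carrier (top_alg X)\<rbrakk> \<Longrightarrow>
        f1 (ract X m x) = ract Y (f1 m) (f0 x)"
  using assms by (auto simp: xmod_hom_def)

lemma int_groupoid_homD:
  assumes "(f, f0) \<in> int_groupoid_hom K G H"
  shows "f \<in> leibniz_hom K (mor_alg G) (mor_alg H)" "f0 \<in> leibniz_hom K (obj_alg G) (obj_alg H)"
    and "g \<in> carrier (mor_alg G) \<Longrightarrow> src H (f g) = f0 (src G g)"
    and "g \<in> carrier (mor_alg G) \<Longrightarrow> tgt H (f g) = f0 (tgt G g)"
    and "x \<in> carrier (obj_alg G) \<Longrightarrow> f (ident G x) = ident H (f0 x)"
    and "\<lbrakk>h \<in> carrier (mor_alg G); g \<in> carrier (mor_alg G); src G h = tgt G g\<rbrakk> \<Longrightarrow>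
        f (comp_arr G h g) = comp_arr H (f h) (f g)"
  using assms by (auto simp: int_groupoid_hom_def)

lemma groupoid_hom_of_xmod_hom:
  assumes X: "crossed_module K X" and Y: "crossed_module K Y" and f: "(f1, f0) \<in> xmod_hom K X Y"
  shows "(map_prod f1 f0, f0) \<in> int_groupoid_hom K (groupoid_of_xmod X) (groupoid_of_xmod Y)"
proof -
  interpret X: xmodule K X by unfold_locales fact
  interpret Y: xmodule K Y by unfold_locales fact
  note f1 = leibniz_homD[OF xmod_homD(1)[OF f]] and f0 = leibniz_homD[OF xmod_homD(2)[OF f]]
  have "map_prod f1 f0 \<in> leibniz_hom K (mor_alg (groupoid_of_xmod X)) (mor_alg (groupoid_of_xmod Y))"
    by (rule leibniz_homI) (auto simp: f1 f0 xmod_homD(4,5)[OF f])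
  moreover have "f1 \<zero>\<^bsub>top_alg X\<^esub> = \<zero>\<^bsub>top_alg Y\<^esub>"
    using xmod_homD(1)[OF f] X.top.abelian_group_axioms Y.top.abelian_group_axioms
    by (rule leibniz_hom_zero)
  ultimately show ?thesis
    unfolding int_groupoid_hom_def
    by (auto simp: f1 f0 xmod_homD(2,3)[OF f])
qed

text \<open>Because \<open>(m, x) = (m, 0) + \<epsilon>(x)\<close>, a functor is determined by its values on the arrows
  \<open>(m, 0)\<close> with source \<open>0\<close> and by its object map.\<close>

lemma groupoid_hom_imp_xmod_hom:
  assumes X: "crossed_module K X" and Y: "crossed_module K Y"
    and g: "(g, g0) \<in> int_groupoid_hom K (groupoid_of_xmod X) (groupoid_of_xmod Y)"
  defines "g1 \<equiv> \<lambda>m. fst (g (m, \<zero>\<^bsub>base_alg X\<^esub>))"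
  shows "(g1, g0) \<in> xmod_hom K X Y"
    and "\<lbrakk>m \<in> carrier (top_alg X); x \<in> carrier (base_alg X)\<rbrakk> \<Longrightarrow> g (m, x) = (g1 m, g0 x)"
proof -
  interpret X: xmodule K X by unfold_locales fact
  interpret Y: xmodule K Y by unfold_locales fact
  note gD = int_groupoid_homD[OF g, simplified]
  note g' = leibniz_homD[OF gD(1), simplified] and g0 = leibniz_homD[OF gD(2)]
  have g0_zero [simp]: "g0 \<zero>\<^bsub>base_alg X\<^esub> = \<zero>\<^bsub>base_alg Y\<^esub>"
    using gD(2) X.base.abelian_group_axioms Y.base.abelian_group_axioms
    by (rule leibniz_hom_zero)
  have g_top: "g (m, \<zero>\<^bsub>base_alg X\<^esub>) = (g1 m, \<zero>\<^bsub>base_alg Y\<^esub>)" if "m \<in> carrier (top_alg X)" for m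
    using gD(3)[of "(m, \<zero>\<^bsub>base_alg X\<^esub>)"] that by (simp add: g1_def prod_eq_iff)
  have g1_closed: "g1 m \<in> carrier (top_alg Y)" if "m \<in> carrier (top_alg X)" for m
    using g'(1)[of "(m, \<zero>\<^bsub>base_alg X\<^esub>)"] that g_top[OF that] by simp
  show g_eq: "g (m, x) = (g1 m, g0 x)"
    if "m \<in> carrier (top_alg X)" "x \<in> carrier (base_alg X)" for m x
    using g'(2)[of "(m, \<zero>\<^bsub>base_alg X\<^esub>)" "(\<zero>\<^bsub>top_alg X\<^esub>, x)"] that g0(1)
    by (simp add: g_top gD(5) g1_closed)
  have g1_zero: "g1 \<zero>\<^bsub>top_alg X\<^esub> = \<zero>\<^bsub>top_alg Y\<^esub>"
    using gD(5)[of "\<zero>\<^bsub>base_alg X\<^esub>"] by (simp add: g1_def)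
  have "g1 \<in> leibniz_hom K (top_alg X) (top_alg Y)"
  proof (rule leibniz_homI)
    fix m n assume mn: "m \<in> carrier (top_alg X)" "n \<in> carrier (top_alg X)"
    show "g1 (m \<oplus>\<^bsub>top_alg X\<^esub> n) = g1 m \<oplus>\<^bsub>top_alg Y\<^esub> g1 n"
      using g'(2)[of "(m, \<zero>\<^bsub>base_alg X\<^esub>)" "(n, \<zero>\<^bsub>base_alg X\<^esub>)"] mn by (simp add: g_top)
    show "g1 (m \<otimes>\<^bsub>top_alg X\<^esub> n) = g1 m \<otimes>\<^bsub>top_alg Y\<^esub> g1 n"
      using g'(4)[of "(m, \<zero>\<^bsub>base_alg X\<^esub>)" "(n, \<zero>\<^bsub>base_alg X\<^esub>)"] mn by (simp add: g_top g1_closed)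
  next
    fix c m assume "c \<in> carrier K" "m \<in> carrier (top_alg X)"
    then show "g1 (c \<odot>\<^bsub>top_alg X\<^esub> m) = c \<odot>\<^bsub>top_alg Y\<^esub> g1 m"
      using g'(3)[of c "(m, \<zero>\<^bsub>base_alg X\<^esub>)"] by (simp add: g_top)
  qed (rule g1_closed)
  moreover have "g0 (bdry X m) = bdry Y (g1 m)" if "m \<in> carrier (top_alg X)" for m
    using gD(4)[of "(m, \<zero>\<^bsub>base_alg X\<^esub>)"] that by (simp add: g_top g1_closed)
  moreover have "g1 (lact X x m) = lact Y (g0 x) (g1 m)" "g1 (ract X m x) = ract Y (g1 m) (g0 x)"
    if "x \<in> carrier (base_alg X)" "m \<in> carrier (top_alg X)" for x m
    using g'(4)[of "(\<zero>\<^bsub>top_alg X\<^esub>, x)" "(m, \<zero>\<^bsub>base_alg X\<^esub>)"]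
      g'(4)[of "(m, \<zero>\<^bsub>base_alg X\<^esub>)" "(\<zero>\<^bsub>top_alg X\<^esub>, x)"] that
    by (simp_all add: g_eq g1_closed g0 g1_zero)
  ultimately show "(g1, g0) \<in> xmod_hom K X Y"
    using gD(2) by (simp add: xmod_hom_def)
qed

lemma groupoid_covering_of_xmod:
  assumes X: "crossed_module K X" and "xmod_covering K X Y (p1, p0)"
  shows "groupoid_covering K (groupoid_of_xmod X) (groupoid_of_xmod Y) (map_prod p1 p0, p0)"
proof -
  have Y: "crossed_module K Y" and p: "(p1, p0) \<in> xmod_hom K Y X"
    and iso: "p1 \<in> leibniz_iso K (top_alg Y) (top_alg X)"
    using assms(2) by (auto simp: xmod_covering_def)
  interpret X: xmodule K X by unfold_locales fact
  interpret Y: xmodule K Y by unfold_locales fact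
  let ?GX = "groupoid_of_xmod X" and ?GY = "groupoid_of_xmod Y"
  let ?P = "leibniz_pullback (mor_alg ?GX) (base_alg Y) snd p0"
  let ?f = "\<lambda>h. (map_prod p1 p0 h, snd h)"
  note p1 = leibniz_homD[OF xmod_homD(1)[OF p]] and p0 = leibniz_homD[OF xmod_homD(2)[OF p]]
  have GY: "internal_groupoid K ?GY"
    by (rule Y.internal_groupoid_of_xmod)
  have bij: "bij_betw p1 (carrier (top_alg Y)) (carrier (top_alg X))"
    using leibniz_isoD(2)[OF iso] .
  have "bij_betw ?f (carrier (mor_alg ?GY)) (carrier ?P)"
    by (rule bij_betw_byWitness[where f' = "\<lambda>((l, a), x). (inv_into (carrier (top_alg Y)) p1 l, x)"])
      (use bij p0(1) in \<open>auto simp: bij_betw_inv_into_left bij_betw_inv_into_right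
        dest: bij_betw_apply bij_betw_apply[OF bij_betw_inv_into]\<close>)
  moreover have "?f \<in> leibniz_hom K (mor_alg ?GY) ?P"
    by (rule leibniz_homI) (auto simp: p0 p1 xmod_homD(4,5)[OF p])
  ultimately have "?f \<in> leibniz_iso K (mor_alg ?GY) ?P"
    using internal_groupoidD(2)[OF GY] by (intro leibniz_isoI)
  then show ?thesis
    unfolding groupoid_covering_def
    using GY groupoid_hom_of_xmod_hom[OF Y X p] by simp
qed

section \<open>Relabelling the arrows of an internal groupoid\<close>

definition relabel_algebra :: "('m \<Rightarrow> 'n) \<Rightarrow> ('k, 'm) module \<Rightarrow> ('k, 'n) module" where
  "relabel_algebra e L =
    \<lparr>carrier = e ` carrier L,
     mult = (\<lambda>x y. e (inv_into UNIV e x \<otimes>\<^bsub>L\<^esub> inv_into UNIV e y)),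
     one = undefined,
     zero = e \<zero>\<^bsub>L\<^esub>,
     add = (\<lambda>x y. e (inv_into UNIV e x \<oplus>\<^bsub>L\<^esub> inv_into UNIV e y)),
     smult = (\<lambda>c x. e (c \<odot>\<^bsub>L\<^esub> inv_into UNIV e x))\<rparr>"

definition relabel_groupoid ::
  "('m \<Rightarrow> 'n) \<Rightarrow> ('k, 'm, 'o) int_groupoid \<Rightarrow> ('k, 'n, 'o) int_groupoid" where
  "relabel_groupoid e G =
    \<lparr>mor_alg = relabel_algebra e (mor_alg G),
     obj_alg = obj_alg G,
     src = (\<lambda>h. src G (inv_into UNIV e h)),
     tgt = (\<lambda>h. tgt G (inv_into UNIV e h)),
     ident = (\<lambda>x. e (ident G x)),
     comp_arr = (\<lambda>h g. e (comp_arr G (inv_into UNIV e h) (inv_into UNIV e g)))\<rparr>"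

lemma relabel_algebra_simps:
  assumes "inj e"
  shows "carrier (relabel_algebra e L) = e ` carrier L"
    and "\<zero>\<^bsub>relabel_algebra e L\<^esub> = e \<zero>\<^bsub>L\<^esub>"
    and "e x \<otimes>\<^bsub>relabel_algebra e L\<^esub> e y = e (x \<otimes>\<^bsub>L\<^esub> y)"
    and "e x \<oplus>\<^bsub>relabel_algebra e L\<^esub> e y = e (x \<oplus>\<^bsub>L\<^esub> y)"
    and "c \<odot>\<^bsub>relabel_algebra e L\<^esub> e x = e (c \<odot>\<^bsub>L\<^esub> x)"
  using assms by (simp_all add: relabel_algebra_def)

lemma relabel_groupoid_simps:
  assumes "inj e"
  shows "mor_alg (relabel_groupoid e G) = relabel_algebra e (mor_alg G)"
    and "obj_alg (relabel_groupoid e G) = obj_alg G"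
    and "src (relabel_groupoid e G) (e h) = src G h"
    and "tgt (relabel_groupoid e G) (e h) = tgt G h"
    and "ident (relabel_groupoid e G) x = e (ident G x)"
    and "comp_arr (relabel_groupoid e G) (e h) (e g) = e (comp_arr G h g)"
  using assms by (simp_all add: relabel_groupoid_def)

lemma leibniz_hom_relabel_dom:
  assumes "inj e"
  shows "f \<in> leibniz_hom K (relabel_algebra e L) M \<longleftrightarrow> (\<lambda>x. f (e x)) \<in> leibniz_hom K L M"
  using assms by (simp add: leibniz_hom_def relabel_algebra_simps Pi_iff)

lemma leibniz_hom_relabel_cod:
  assumes "inj e"
  shows "(\<lambda>x. e (f x)) \<in> leibniz_hom K L (relabel_algebra e M) \<longleftrightarrow> f \<in> leibniz_hom K L M"
  using assms by (auto simp: leibniz_hom_def relabel_algebra_simps Pi_iff inj_image_mem_iff inj_eq)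

lemma leibniz_algebra_relabel:
  assumes "leibniz_algebra K L" "inj e"
  shows "leibniz_algebra K (relabel_algebra e L)"
proof (rule leibniz_algebra_hom_image[OF assms(1)])
  show "e \<in> leibniz_hom K L (relabel_algebra e L)"
    using assms(2) by (intro leibniz_homI) (simp_all add: relabel_algebra_simps)
qed (simp_all add: relabel_algebra_simps assms(2))

lemma internal_groupoid_relabel:
  assumes G: "internal_groupoid K G" and e: "inj e"
  shows "internal_groupoid K (relabel_groupoid e G)"
proof -
  note G' = internal_groupoidD[OF G]
  note simps = relabel_groupoid_simps[OF e] relabel_algebra_simps[OF e] inj_eq[OF e]
  have "groupoid_laws (relabel_groupoid e G)"
    using G'(1) unfolding groupoid_laws_def Let_def
    by (simp add: simps Pi_iff inj_image_mem_iff[OF e])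
  moreover have "(\<lambda>(h, g). comp_arr (relabel_groupoid e G) h g) \<in>
        leibniz_hom K (leibniz_pullback (relabel_algebra e (mor_alg G)) (relabel_algebra e (mor_alg G))
          (src (relabel_groupoid e G)) (tgt (relabel_groupoid e G))) (relabel_algebra e (mor_alg G))"
    using leibniz_homD[OF G'(7)]
    by (intro leibniz_homI) (auto simp: simps)
  moreover have "ident (relabel_groupoid e G) \<in> leibniz_hom K (obj_alg G) (relabel_algebra e (mor_alg G))"
    using iffD2[OF leibniz_hom_relabel_cod[OF e] G'(6)] by (simp add: relabel_groupoid_def)
  ultimately show ?thesis
    unfolding internal_groupoid_def relabel_groupoid_simps(1,2)[OF e]
    using G'(2-5)
    by (simp add: leibniz_algebra_relabel e leibniz_hom_relabel_dom simps)
qed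

lemma int_groupoid_hom_relabel_dom:
  assumes e: "inj e"
  shows "(f, f0) \<in> int_groupoid_hom K (relabel_groupoid e G) H \<longleftrightarrow>
    (\<lambda>x. f (e x), f0) \<in> int_groupoid_hom K G H"
  unfolding int_groupoid_hom_def
  by (simp add: leibniz_hom_relabel_dom relabel_groupoid_simps relabel_algebra_simps e)

lemma int_groupoid_hom_relabel_cod:
  assumes e: "inj e"
  shows "(\<lambda>x. e (f x), f0) \<in> int_groupoid_hom K G (relabel_groupoid e H) \<longleftrightarrow>
    (f, f0) \<in> int_groupoid_hom K G H"
  unfolding int_groupoid_hom_def
  by (simp add: leibniz_hom_relabel_cod relabel_groupoid_simps e inj_eq)

lemma groupoid_covering_relabel:
  assumes "groupoid_covering K G H (p, p0)" and e: "inj e"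
  shows "groupoid_covering K G (relabel_groupoid e H) (\<lambda>h. p (inv_into UNIV e h), p0)"
proof -
  have H: "internal_groupoid K H" and p: "(p, p0) \<in> int_groupoid_hom K H G"
    and iso: "(\<lambda>h. (p h, src H h)) \<in>
      leibniz_iso K (mor_alg H) (leibniz_pullback (mor_alg G) (obj_alg H) (src G) p0)" (is "?i \<in> leibniz_iso K _ ?P")
    using assms(1) by (simp_all add: groupoid_covering_def)
  let ?H = "relabel_groupoid e H"
  let ?j = "\<lambda>h. (p (inv_into UNIV e h), src ?H h)"
  have je: "(\<lambda>h. ?j (e h)) = ?i"
    by (simp add: relabel_groupoid_simps e)
  have "?j \<in> leibniz_hom K (mor_alg ?H) ?P"
    using leibniz_isoD(1)[OF iso] je by (simp add: leibniz_hom_relabel_dom relabel_groupoid_simps e)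
  moreover have "bij_betw ?j (e ` carrier (mor_alg H)) (carrier ?P)"
    using leibniz_isoD(2)[OF iso] je
      bij_betw_comp_iff[OF inj_on_imp_bij_betw[OF inj_on_subset[OF e subset_UNIV]], where f' = ?j and A'' = "carrier ?P"]
    by (simp add: comp_def)
  ultimately have "?j \<in> leibniz_iso K (mor_alg ?H) ?P"
    using internal_groupoidD(2)[OF H]
    by (intro leibniz_isoI) (simp_all add: relabel_groupoid_simps relabel_algebra_simps leibniz_algebra_relabel e)
  then show ?thesis
    unfolding groupoid_covering_def
    using internal_groupoid_relabel[OF H e] p
    by (simp add: int_groupoid_hom_relabel_dom e relabel_groupoid_simps(2))
qed

section \<open>The crossed module of an internal groupoid\<close>

lemma leibniz_actionI:
  assumes L': "leibniz_algebra K L'"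
    and la: "bilinear_map K L L' L' la" and ra: "bilinear_map K L' L L' ra"
    and "\<And>x m n. \<lbrakk>x \<in> carrier L; m \<in> carrier L'; n \<in> carrier L'\<rbrakk> \<Longrightarrow>
        la x (m \<otimes>\<^bsub>L'\<^esub> n) \<oplus>\<^bsub>L'\<^esub> la x n \<otimes>\<^bsub>L'\<^esub> m = la x m \<otimes>\<^bsub>L'\<^esub> n"
    and "\<And>x m n. \<lbrakk>x \<in> carrier L; m \<in> carrier L'; n \<in> carrier L'\<rbrakk> \<Longrightarrow>
        m \<otimes>\<^bsub>L'\<^esub> la x n \<oplus>\<^bsub>L'\<^esub> ra (m \<otimes>\<^bsub>L'\<^esub> n) x = ra m x \<otimes>\<^bsub>L'\<^esub> n"
    and "\<And>x m n. \<lbrakk>x \<in> carrier L; m \<in> carrier L'; n \<in> carrier L'\<rbrakk> \<Longrightarrow>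
        m \<otimes>\<^bsub>L'\<^esub> ra n x \<oplus>\<^bsub>L'\<^esub> ra m x \<otimes>\<^bsub>L'\<^esub> n = ra (m \<otimes>\<^bsub>L'\<^esub> n) x"
    and "\<And>x y m. \<lbrakk>x \<in> carrier L; y \<in> carrier L; m \<in> carrier L'\<rbrakk> \<Longrightarrow>
        la x (la y m) \<oplus>\<^bsub>L'\<^esub> ra (la x m) y = la (x \<otimes>\<^bsub>L\<^esub> y) m"
    and "\<And>x y m. \<lbrakk>x \<in> carrier L; y \<in> carrier L; m \<in> carrier L'\<rbrakk> \<Longrightarrow>
        la x (ra m y) \<oplus>\<^bsub>L'\<^esub> la (x \<otimes>\<^bsub>L\<^esub> y) m = ra (la x m) y"
    and "\<And>x y m. \<lbrakk>x \<in> carrier L; y \<in> carrier L; m \<in> carrier L'\<rbrakk> \<Longrightarrow>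
        ra m (x \<otimes>\<^bsub>L\<^esub> y) \<oplus>\<^bsub>L'\<^esub> ra (ra m y) x = ra (ra m x) y"
    and L: "leibniz_algebra K L"
  shows "leibniz_action K L L' la ra"
proof -
  interpret L': leibniz_algebra K L' by fact
  interpret L: leibniz_algebra K L by fact
  note closed = bilinear_mapD(1)[OF la] bilinear_mapD(1)[OF ra]
  show ?thesis
    unfolding leibniz_action_def using assms(2-9) by (simp add: closed L'.M.eq_minus_iff)
qed

locale internal_grpd =
  fixes K :: "'k ring" and H :: "('k, 'm, 'o) int_groupoid"
  assumes internal_groupoid: "internal_groupoid K H"

sublocale internal_grpd \<subseteq> mor: leibniz_algebra K "mor_alg H"
  using internal_groupoidD(2)[OF internal_groupoid] .

sublocale internal_grpd \<subseteq> obj: leibniz_algebra K "obj_alg H"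
  using internal_groupoidD(3)[OF internal_groupoid] .

definition xmod_of_groupoid :: "('k, 'm, 'o) int_groupoid \<Rightarrow> ('k, 'm, 'o) xmod" where
  "xmod_of_groupoid H =
    \<lparr>top_alg = (mor_alg H)\<lparr>carrier := {m \<in> carrier (mor_alg H). src H m = \<zero>\<^bsub>obj_alg H\<^esub>}\<rparr>,
     base_alg = obj_alg H,
     bdry = tgt H,
     lact = (\<lambda>x m. ident H x \<otimes>\<^bsub>mor_alg H\<^esub> m),
     ract = (\<lambda>m x. m \<otimes>\<^bsub>mor_alg H\<^esub> ident H x)\<rparr>"

lemma xmod_of_groupoid_simps [simp]:
  "carrier (top_alg (xmod_of_groupoid H)) = {m \<in> carrier (mor_alg H). src H m = \<zero>\<^bsub>obj_alg H\<^esub>}"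
  "\<zero>\<^bsub>top_alg (xmod_of_groupoid H)\<^esub> = \<zero>\<^bsub>mor_alg H\<^esub>"
  "m \<oplus>\<^bsub>top_alg (xmod_of_groupoid H)\<^esub> n = m \<oplus>\<^bsub>mor_alg H\<^esub> n"
  "m \<otimes>\<^bsub>top_alg (xmod_of_groupoid H)\<^esub> n = m \<otimes>\<^bsub>mor_alg H\<^esub> n"
  "c \<odot>\<^bsub>top_alg (xmod_of_groupoid H)\<^esub> m = c \<odot>\<^bsub>mor_alg H\<^esub> m"
  "base_alg (xmod_of_groupoid H) = obj_alg H"
  "bdry (xmod_of_groupoid H) = tgt H"
  "lact (xmod_of_groupoid H) x m = ident H x \<otimes>\<^bsub>mor_alg H\<^esub> m"
  "ract (xmod_of_groupoid H) m x = m \<otimes>\<^bsub>mor_alg H\<^esub> ident H x"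
  by (simp_all add: xmod_of_groupoid_def)

context internal_grpd
begin

lemmas src_hom = internal_groupoidD(4)[OF internal_groupoid]
lemmas tgt_hom = internal_groupoidD(5)[OF internal_groupoid]
lemmas ident_hom = internal_groupoidD(6)[OF internal_groupoid]
lemmas comp_hom = internal_groupoidD(7)[OF internal_groupoid]
lemmas structure_closed [simp] =
  leibniz_homD(1)[OF src_hom] leibniz_homD(1)[OF tgt_hom] leibniz_homD(1)[OF ident_hom]
lemmas src_simps = leibniz_homD(2-4)[OF src_hom]
  leibniz_hom_inv[OF src_hom mor.abelian_group_axioms obj.abelian_group_axioms]
lemmas tgt_simps = leibniz_homD(2-4)[OF tgt_hom]
  leibniz_hom_inv[OF tgt_hom mor.abelian_group_axioms obj.abelian_group_axioms]
lemmas ident_simps = leibniz_homD(2-4)[OF ident_hom]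
lemmas structure_zero [simp] =
  leibniz_hom_zero[OF src_hom mor.abelian_group_axioms obj.abelian_group_axioms]
  leibniz_hom_zero[OF tgt_hom mor.abelian_group_axioms obj.abelian_group_axioms]
  leibniz_hom_zero[OF ident_hom obj.abelian_group_axioms mor.abelian_group_axioms]

lemma
  shows src_ident [simp]: "x \<in> carrier (obj_alg H) \<Longrightarrow> src H (ident H x) = x"
    and tgt_ident [simp]: "x \<in> carrier (obj_alg H) \<Longrightarrow> tgt H (ident H x) = x"
    and comp_ident_right: "g \<in> carrier (mor_alg H) \<Longrightarrow> comp_arr H g (ident H (src H g)) = g"
    and comp_ident_left: "g \<in> carrier (mor_alg H) \<Longrightarrow> comp_arr H (ident H (tgt H g)) g = g"
    and comp_closed: "\<lbrakk>h \<in> carrier (mor_alg H); g \<in> carrier (mor_alg H); src H h = tgt H g\<rbrakk> \<Longrightarrow>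
      comp_arr H h g \<in> carrier (mor_alg H)"
  using internal_groupoidD(1)[OF internal_groupoid] unfolding groupoid_laws_def Let_def by auto

text \<open>Both sides are the composite of \<open>(h, g) + (\<epsilon>(x), \<epsilon>(x)) = (h, \<epsilon>(x)) + (\<epsilon>(x), g)\<close>
  with \<open>x = d\<^sub>0(h) = d\<^sub>1(g)\<close>.\<close>

lemma comp_add_ident:
  assumes "h \<in> carrier (mor_alg H)" "g \<in> carrier (mor_alg H)" "src H h = tgt H g"
  shows "comp_arr H h g \<oplus>\<^bsub>mor_alg H\<^esub> ident H (src H h) = h \<oplus>\<^bsub>mor_alg H\<^esub> g"
proof -
  define i where "i = ident H (src H h)"
  have i: "i \<in> carrier (mor_alg H)" "src H i = src H h" "tgt H i = src H h" "comp_arr H i i = i"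
    using assms comp_ident_right[of i] by (simp_all add: i_def)
  have "comp_arr H h g \<oplus>\<^bsub>mor_alg H\<^esub> comp_arr H i i = comp_arr H (h \<oplus>\<^bsub>mor_alg H\<^esub> i) (i \<oplus>\<^bsub>mor_alg H\<^esub> g)"
    using leibniz_homD(2)[OF comp_hom, of "(h, g)" "(i, i)"] assms i by (simp add: mor.M.a_comm)
  also have "\<dots> = comp_arr H h i \<oplus>\<^bsub>mor_alg H\<^esub> comp_arr H i g"
    using leibniz_homD(2)[OF comp_hom, of "(h, i)" "(i, g)"] assms i by simp
  also have "\<dots> = h \<oplus>\<^bsub>mor_alg H\<^esub> g"
    using comp_ident_right[OF assms(1)] comp_ident_left[OF assms(2)] assms(3) by (simp add: i_def)
  finally show ?thesis
    by (simp add: i) (simp add: i_def)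
qed

lemma bracket_src_kernel_tgt_kernel:
  assumes "m \<in> carrier (mor_alg H)" "src H m = \<zero>\<^bsub>obj_alg H\<^esub>"
    and "k \<in> carrier (mor_alg H)" "tgt H k = \<zero>\<^bsub>obj_alg H\<^esub>"
  shows "m \<otimes>\<^bsub>mor_alg H\<^esub> k = \<zero>\<^bsub>mor_alg H\<^esub>" "k \<otimes>\<^bsub>mor_alg H\<^esub> m = \<zero>\<^bsub>mor_alg H\<^esub>"
proof -
  have units: "comp_arr H m \<zero>\<^bsub>mor_alg H\<^esub> = m" "comp_arr H \<zero>\<^bsub>mor_alg H\<^esub> k = k"
      "comp_arr H \<zero>\<^bsub>mor_alg H\<^esub> \<zero>\<^bsub>mor_alg H\<^esub> = \<zero>\<^bsub>mor_alg H\<^esub>"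
    using comp_ident_right[of m] comp_ident_left[of k] comp_ident_left[of "\<zero>\<^bsub>mor_alg H\<^esub>"] assms
    by simp_all
  show "m \<otimes>\<^bsub>mor_alg H\<^esub> k = \<zero>\<^bsub>mor_alg H\<^esub>"
    using leibniz_homD(4)[OF comp_hom, of "(m, \<zero>\<^bsub>mor_alg H\<^esub>)" "(\<zero>\<^bsub>mor_alg H\<^esub>, k)"] assms
    by (simp add: units)
  show "k \<otimes>\<^bsub>mor_alg H\<^esub> m = \<zero>\<^bsub>mor_alg H\<^esub>"
    using leibniz_homD(4)[OF comp_hom, of "(\<zero>\<^bsub>mor_alg H\<^esub>, k)" "(m, \<zero>\<^bsub>mor_alg H\<^esub>)"] assms
    by (simp add: units)
qed

lemma bracket_ident_tgt:
  assumes "m \<in> carrier (mor_alg H)" "src H m = \<zero>\<^bsub>obj_alg H\<^esub>" and n: "n \<in> carrier (mor_alg H)"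
  shows "m \<otimes>\<^bsub>mor_alg H\<^esub> ident H (tgt H n) = m \<otimes>\<^bsub>mor_alg H\<^esub> n"
    and "ident H (tgt H n) \<otimes>\<^bsub>mor_alg H\<^esub> m = n \<otimes>\<^bsub>mor_alg H\<^esub> m"
proof -
  define k where "k = n \<oplus>\<^bsub>mor_alg H\<^esub> \<ominus>\<^bsub>mor_alg H\<^esub> ident H (tgt H n)"
  have k: "k \<in> carrier (mor_alg H)" "tgt H k = \<zero>\<^bsub>obj_alg H\<^esub>"
    using n by (simp_all add: k_def tgt_simps obj.M.r_neg)
  have n_eq: "n = k \<oplus>\<^bsub>mor_alg H\<^esub> ident H (tgt H n)"
    using n by (simp add: k_def mor.M.a_assoc mor.M.l_neg)
  show "m \<otimes>\<^bsub>mor_alg H\<^esub> ident H (tgt H n) = m \<otimes>\<^bsub>mor_alg H\<^esub> n"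
    using assms k arg_cong[OF n_eq, of "\<lambda>n. m \<otimes>\<^bsub>mor_alg H\<^esub> n"]
    by (simp add: mor.bracket_add_right bracket_src_kernel_tgt_kernel)
  show "ident H (tgt H n) \<otimes>\<^bsub>mor_alg H\<^esub> m = n \<otimes>\<^bsub>mor_alg H\<^esub> m"
    using assms k arg_cong[OF n_eq, of "\<lambda>n. n \<otimes>\<^bsub>mor_alg H\<^esub> m"]
    by (simp add: mor.bracket_add_left bracket_src_kernel_tgt_kernel)
qed

lemma crossed_module_of_groupoid: "crossed_module K (xmod_of_groupoid H)"
proof -
  let ?Y = "xmod_of_groupoid H"
  have top: "leibniz_algebra K (top_alg ?Y)"
    unfolding xmod_of_groupoid_def xmod.simps
    by (rule leibniz_subalgebra[OF mor.leibniz_algebra_axioms]) (auto simp: src_simps)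
  have "leibniz_action K (obj_alg H) (top_alg ?Y) (lact ?Y) (ract ?Y)"
    by (rule leibniz_actionI[OF top])
      (auto simp: bilinear_map_def src_simps ident_simps mor.bracket_add_left mor.bracket_add_right
        mor.bracket_smult_left mor.bracket_smult_right mor.leibniz_identity_add
        obj.leibniz_algebra_axioms)
  moreover have "tgt H \<in> leibniz_hom K (top_alg ?Y) (obj_alg H)"
    by (rule leibniz_homI) (auto simp: tgt_simps)
  ultimately show ?thesis
    unfolding crossed_module_def
    using top obj.leibniz_algebra_axioms by (simp add: tgt_simps bracket_ident_tgt)
qed

lemma semidirect_splitting_hom:
  "(\<lambda>(m, x). m \<oplus>\<^bsub>mor_alg H\<^esub> ident H x, \<lambda>x. x) \<in>
    int_groupoid_hom K (groupoid_of_xmod (xmod_of_groupoid H)) H"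
proof -
  let ?S = "mor_alg (groupoid_of_xmod (xmod_of_groupoid H))"
  let ?f = "\<lambda>(m, x). m \<oplus>\<^bsub>mor_alg H\<^esub> ident H x"
  have "?f \<in> leibniz_hom K ?S (mor_alg H)"
    by (rule leibniz_homI)
      (auto simp: ident_simps mor.M.a_ac mor.smult_r_distr mor.bracket_add_left mor.bracket_add_right)
  moreover have "(\<lambda>x. x) \<in> leibniz_hom K (obj_alg H) (obj_alg H)"
    by (rule leibniz_homI) auto
  moreover have "m' \<oplus>\<^bsub>mor_alg H\<^esub> m \<oplus>\<^bsub>mor_alg H\<^esub> ident H x =
      comp_arr H (m' \<oplus>\<^bsub>mor_alg H\<^esub> ident H (tgt H m \<oplus>\<^bsub>obj_alg H\<^esub> x)) (m \<oplus>\<^bsub>mor_alg H\<^esub> ident H x)"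
    if m: "m' \<in> carrier (mor_alg H)" "src H m' = \<zero>\<^bsub>obj_alg H\<^esub>" "m \<in> carrier (mor_alg H)"
      "src H m = \<zero>\<^bsub>obj_alg H\<^esub>" "x \<in> carrier (obj_alg H)" for m' m x
  proof -
    define i where "i = ident H (tgt H m \<oplus>\<^bsub>obj_alg H\<^esub> x)"
    define c where "c = comp_arr H (m' \<oplus>\<^bsub>mor_alg H\<^esub> i) (m \<oplus>\<^bsub>mor_alg H\<^esub> ident H x)"
    have i: "i \<in> carrier (mor_alg H)" "src H i = tgt H m \<oplus>\<^bsub>obj_alg H\<^esub> x"
      using m by (simp_all add: i_def)
    have c: "c \<in> carrier (mor_alg H)"
      unfolding c_def by (rule comp_closed) (use m i in \<open>simp_all add: src_simps tgt_simps\<close>)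
    have "c \<oplus>\<^bsub>mor_alg H\<^esub> i = (m' \<oplus>\<^bsub>mor_alg H\<^esub> i) \<oplus>\<^bsub>mor_alg H\<^esub> (m \<oplus>\<^bsub>mor_alg H\<^esub> ident H x)"
      using comp_add_ident[of "m' \<oplus>\<^bsub>mor_alg H\<^esub> i" "m \<oplus>\<^bsub>mor_alg H\<^esub> ident H x"] m i
      by (simp add: src_simps tgt_simps c_def) (simp add: i_def)
    also have "\<dots> = (m' \<oplus>\<^bsub>mor_alg H\<^esub> m \<oplus>\<^bsub>mor_alg H\<^esub> ident H x) \<oplus>\<^bsub>mor_alg H\<^esub> i"
      using m i by (simp add: mor.M.a_ac)
    finally have "c = m' \<oplus>\<^bsub>mor_alg H\<^esub> m \<oplus>\<^bsub>mor_alg H\<^esub> ident H x"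
      by (rule iffD1[OF mor.M.add.right_cancel, rotated -1]) (use m i c in simp_all)
    then show ?thesis
      by (simp add: c_def i_def)
  qed
  ultimately show ?thesis
    unfolding int_groupoid_hom_def by (auto simp: src_simps tgt_simps)
qed

lemma semidirect_splitting_bij:
  "bij_betw (\<lambda>(m, x). m \<oplus>\<^bsub>mor_alg H\<^esub> ident H x)
    (carrier (mor_alg (groupoid_of_xmod (xmod_of_groupoid H)))) (carrier (mor_alg H))"
  by (rule bij_betw_byWitness[where
        f' = "\<lambda>h. (h \<oplus>\<^bsub>mor_alg H\<^esub> \<ominus>\<^bsub>mor_alg H\<^esub> ident H (src H h), src H h)"])
    (auto simp: src_simps mor.M.a_assoc mor.M.l_neg mor.M.r_neg obj.M.r_neg)

end

lemma xmod_covering_of_groupoid: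
  assumes X: "crossed_module K X" and cov: "groupoid_covering K (groupoid_of_xmod X) H (p, p0)"
  shows "xmod_covering K X (xmod_of_groupoid H) (\<lambda>m. fst (p m), p0)"
    and "\<lbrakk>m \<in> carrier (mor_alg H); src H m = \<zero>\<^bsub>obj_alg H\<^esub>; x \<in> carrier (obj_alg H)\<rbrakk> \<Longrightarrow>
      p (m \<oplus>\<^bsub>mor_alg H\<^esub> ident H x) = (fst (p m), p0 x)"
proof -
  interpret X: xmodule K X by unfold_locales fact
  interpret H: internal_grpd K H
    using cov by unfold_locales (simp add: groupoid_covering_def)
  let ?Y = "xmod_of_groupoid H"
  have p: "(p, p0) \<in> int_groupoid_hom K H (groupoid_of_xmod X)"
    using cov by (simp add: groupoid_covering_def)
  note pD = int_groupoid_homD[OF p, simplified]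
  note p_simps = leibniz_homD[OF pD(1)] and p0 = leibniz_homD[OF pD(2)]
  have p0_zero [simp]: "p0 \<zero>\<^bsub>obj_alg H\<^esub> = \<zero>\<^bsub>base_alg X\<^esub>"
    using pD(2) H.obj.abelian_group_axioms X.base.abelian_group_axioms
    by (rule leibniz_hom_zero)
  have p_top: "p m = (fst (p m), \<zero>\<^bsub>base_alg X\<^esub>)" "fst (p m) \<in> carrier (top_alg X)"
    if "m \<in> carrier (mor_alg H)" "src H m = \<zero>\<^bsub>obj_alg H\<^esub>" for m
    using pD(3)[of m] p_simps(1)[of m] that by (auto simp: prod_eq_iff mem_Times_iff)
  show "p (m \<oplus>\<^bsub>mor_alg H\<^esub> ident H x) = (fst (p m), p0 x)"
    if "m \<in> carrier (mor_alg H)" "src H m = \<zero>\<^bsub>obj_alg H\<^esub>" "x \<in> carrier (obj_alg H)" for m x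
  proof -
    have "p (m \<oplus>\<^bsub>mor_alg H\<^esub> ident H x) =
        (fst (p m), \<zero>\<^bsub>base_alg X\<^esub>) \<oplus>\<^bsub>mor_alg (groupoid_of_xmod X)\<^esub> (\<zero>\<^bsub>top_alg X\<^esub>, p0 x)"
      using that by (simp add: p_simps(2) pD(5) flip: p_top(1))
    then show ?thesis
      using that p_top(2) p0(1) by simp
  qed
  have p1_hom: "(\<lambda>m. fst (p m)) \<in> leibniz_hom K (top_alg ?Y) (top_alg X)"
  proof (rule leibniz_homI)
    fix m n assume "m \<in> carrier (top_alg ?Y)" "n \<in> carrier (top_alg ?Y)"
    then have mn: "m \<in> carrier (mor_alg H)" "src H m = \<zero>\<^bsub>obj_alg H\<^esub>"
        "n \<in> carrier (mor_alg H)" "src H n = \<zero>\<^bsub>obj_alg H\<^esub>"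
      by auto
    obtain a b where ab: "p m = (a, \<zero>\<^bsub>base_alg X\<^esub>)" "p n = (b, \<zero>\<^bsub>base_alg X\<^esub>)"
        "a \<in> carrier (top_alg X)" "b \<in> carrier (top_alg X)"
      using p_top mn by blast
    show "fst (p (m \<oplus>\<^bsub>top_alg ?Y\<^esub> n)) = fst (p m) \<oplus>\<^bsub>top_alg X\<^esub> fst (p n)"
        "fst (p (m \<otimes>\<^bsub>top_alg ?Y\<^esub> n)) = fst (p m) \<otimes>\<^bsub>top_alg X\<^esub> fst (p n)"
      using mn ab by (simp_all add: p_simps)
  next
    fix c m assume c: "c \<in> carrier K" and "m \<in> carrier (top_alg ?Y)"
    then have m: "m \<in> carrier (mor_alg H)" "src H m = \<zero>\<^bsub>obj_alg H\<^esub>"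
      by auto
    show "fst (p (c \<odot>\<^bsub>top_alg ?Y\<^esub> m)) = c \<odot>\<^bsub>top_alg X\<^esub> fst (p m)"
      by (cases "p m") (use c m in \<open>simp add: p_simps\<close>)
  qed (use p_top(2) in auto)
  moreover have "p0 (tgt H m) = bdry X (fst (p m))"
    if "m \<in> carrier (mor_alg H)" "src H m = \<zero>\<^bsub>obj_alg H\<^esub>" for m
  proof -
    have "p0 (tgt H m) = tgt (groupoid_of_xmod X) (fst (p m), \<zero>\<^bsub>base_alg X\<^esub>)"
      using pD(4)[of m] that by (simp flip: p_top(1))
    then show ?thesis
      using p_top(2)[OF that] by simp
  qed
  moreover have "fst (p (ident H x \<otimes>\<^bsub>mor_alg H\<^esub> m)) = lact X (p0 x) (fst (p m))"
      "fst (p (m \<otimes>\<^bsub>mor_alg H\<^esub> ident H x)) = ract X (fst (p m)) (p0 x)"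
    if m: "m \<in> carrier (mor_alg H)" "src H m = \<zero>\<^bsub>obj_alg H\<^esub>" and x: "x \<in> carrier (obj_alg H)" for m x
  proof -
    obtain a where "p m = (a, \<zero>\<^bsub>base_alg X\<^esub>)" "a \<in> carrier (top_alg X)"
      using p_top[OF m] by blast
    then show "fst (p (ident H x \<otimes>\<^bsub>mor_alg H\<^esub> m)) = lact X (p0 x) (fst (p m))"
        "fst (p (m \<otimes>\<^bsub>mor_alg H\<^esub> ident H x)) = ract X (fst (p m)) (p0 x)"
      using m x p0(1) by (simp_all add: p_simps pD(5))
  qed
  ultimately have p_xmod: "(\<lambda>m. fst (p m), p0) \<in> xmod_hom K ?Y X"
    using pD(2) by (simp add: xmod_hom_def)
  have "bij_betw (\<lambda>m. fst (p m)) (carrier (top_alg ?Y)) (carrier (top_alg X))"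
  proof -
    have bij: "bij_betw (\<lambda>h. (p h, src H h)) (carrier (mor_alg H))
        {(g, x). g \<in> carrier (top_alg X) \<times> carrier (base_alg X) \<and> x \<in> carrier (obj_alg H) \<and> snd g = p0 x}"
      using cov leibniz_isoD(2) by (fastforce simp: groupoid_covering_def)
    have "m = n" if "m \<in> carrier (mor_alg H)" "src H m = \<zero>\<^bsub>obj_alg H\<^esub>"
        "n \<in> carrier (mor_alg H)" "src H n = \<zero>\<^bsub>obj_alg H\<^esub>" "fst (p m) = fst (p n)" for m n
    proof -
      have "p m = p n"
        using p_top(1)[of m] p_top(1)[of n] that by simp
      then show ?thesis
        using inj_onD[OF bij_betw_imp_inj_on[OF bij], of m n] that by simp
    qed
    moreover have "l \<in> (\<lambda>m. fst (p m)) ` carrier (top_alg ?Y)" if "l \<in> carrier (top_alg X)" for l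
    proof -
      have "((l, \<zero>\<^bsub>base_alg X\<^esub>), \<zero>\<^bsub>obj_alg H\<^esub>) \<in> (\<lambda>h. (p h, src H h)) ` carrier (mor_alg H)"
        using that by (simp add: bij_betw_imp_surj_on[OF bij])
      then obtain m where "m \<in> carrier (mor_alg H)" "src H m = \<zero>\<^bsub>obj_alg H\<^esub>" "l = fst (p m)"
        by (elim imageE) (auto simp: prod_eq_iff)
      then show ?thesis
        by simp
    qed
    ultimately show ?thesis
      using p_top(2) by (auto simp: bij_betw_def inj_on_def)
  qed
  then show "xmod_covering K X ?Y (\<lambda>m. fst (p m), p0)"
    unfolding xmod_covering_def
    using H.crossed_module_of_groupoid p_xmod crossed_moduleD(1) p1_hom
    by (auto intro!: leibniz_isoI)
qed

section \<open>Fully faithful and essentially surjective functors\<close>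

lemma is_functorD:
  assumes "is_functor C D F"
  shows "a \<in> Obj C \<Longrightarrow> omap F a \<in> Obj D"
    and "\<lbrakk>a \<in> Obj C; b \<in> Obj C; f \<in> Hom C a b\<rbrakk> \<Longrightarrow> amap F a b f \<in> Hom D (omap F a) (omap F b)"
    and "a \<in> Obj C \<Longrightarrow> amap F a a (Id C a) = Id D (omap F a)"
    and "\<lbrakk>a \<in> Obj C; b \<in> Obj C; c \<in> Obj C; f \<in> Hom C a b; g \<in> Hom C b c\<rbrakk> \<Longrightarrow>
      amap F a c (Comp C a b c g f) =
        Comp D (omap F a) (omap F b) (omap F c) (amap F b c g) (amap F a b f)"
  using assms unfolding is_functor_def by blast+

lemma equivalent_categoriesI:
  assumes C: "category C" and D: "category D" and F: "is_functor C D F"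
    and ff: "\<And>a b. \<lbrakk>a \<in> Obj C; b \<in> Obj C\<rbrakk> \<Longrightarrow>
      bij_betw (amap F a b) (Hom C a b) (Hom D (omap F a) (omap F b))"
    and es: "\<And>d. d \<in> Obj D \<Longrightarrow> \<exists>a \<in> Obj C. isos D (omap F a) d \<noteq> {}"
  shows "equivalent_categories C D"
proof -
  interpret C: category C by fact
  interpret D: category D by fact
  note F_in [simp] = is_functorD(1,2)[OF F] and F_simps = is_functorD(3,4)[OF F]
  let ?F = "omap F"
  define lift where "lift a b = inv_into (Hom C a b) (amap F a b)" for a b
  have lift: "lift a b h \<in> Hom C a b" "amap F a b (lift a b h) = h"
    if "a \<in> Obj C" "b \<in> Obj C" "h \<in> Hom D (?F a) (?F b)" for a b h
    using ff[OF that(1,2)] that(3) unfolding lift_def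
    by (auto simp: bij_betw_def inv_into_into f_inv_into_f)
  have faithful: "f = f'"
    if "amap F a b f = amap F a b f'" "a \<in> Obj C" "b \<in> Obj C" "f \<in> Hom C a b" "f' \<in> Hom C a b"
    for a b f f'
    using inj_onD[OF bij_betw_imp_inj_on[OF ff]] that by metis
  have "\<exists>a \<phi> \<psi>. a \<in> Obj C \<and> \<phi> \<in> Hom D (?F a) d \<and> \<psi> \<in> Hom D d (?F a) \<and>
      Comp D (?F a) d (?F a) \<psi> \<phi> = Id D (?F a) \<and> Comp D d (?F a) d \<phi> \<psi> = Id D d"
    if "d \<in> Obj D" for d
    using es[OF that] by (fastforce simp: isos_def)
  then obtain r \<epsilon> \<theta> where "\<forall>d \<in> Obj D. r d \<in> Obj C \<and> \<epsilon> d \<in> Hom D (?F (r d)) d \<and>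
      \<theta> d \<in> Hom D d (?F (r d)) \<and> Comp D (?F (r d)) d (?F (r d)) (\<theta> d) (\<epsilon> d) = Id D (?F (r d)) \<and>
      Comp D d (?F (r d)) d (\<epsilon> d) (\<theta> d) = Id D d"
    by metis
  then have r [simp]: "\<And>d. d \<in> Obj D \<Longrightarrow> r d \<in> Obj C"
    and \<epsilon> [simp]: "\<And>d. d \<in> Obj D \<Longrightarrow> \<epsilon> d \<in> Hom D (?F (r d)) d"
    and \<theta> [simp]: "\<And>d. d \<in> Obj D \<Longrightarrow> \<theta> d \<in> Hom D d (?F (r d))"
    and \<theta>\<epsilon>: "\<And>d. d \<in> Obj D \<Longrightarrow> Comp D (?F (r d)) d (?F (r d)) (\<theta> d) (\<epsilon> d) = Id D (?F (r d))"
    and \<epsilon>\<theta>: "\<And>d. d \<in> Obj D \<Longrightarrow> Comp D d (?F (r d)) d (\<epsilon> d) (\<theta> d) = Id D d"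
    by blast+
  have \<epsilon>\<theta>_comp: "Comp D a (?F (r d)) d (\<epsilon> d) (Comp D a d (?F (r d)) (\<theta> d) h) = h"
    if "a \<in> Obj D" "d \<in> Obj D" "h \<in> Hom D a d" for a d h
    using D.Comp_assoc[of a d "?F (r d)" d h "\<theta> d" "\<epsilon> d"] that by (simp add: \<epsilon>\<theta> D.Comp_Id_left)
  define conj where "conj a b h =
      Comp D (?F (r a)) b (?F (r b)) (\<theta> b) (Comp D (?F (r a)) a b h (\<epsilon> a))" for a b h
  have conj: "conj a b h \<in> Hom D (?F (r a)) (?F (r b))"
    if "a \<in> Obj D" "b \<in> Obj D" "h \<in> Hom D a b" for a b h
    unfolding conj_def by (intro D.Comp_in) (use that in auto)
  have \<epsilon>_conj: "Comp D (?F (r a)) (?F (r b)) b (\<epsilon> b) (conj a b h) = Comp D (?F (r a)) a b h (\<epsilon> a)"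
    if "a \<in> Obj D" "b \<in> Obj D" "h \<in> Hom D a b" for a b h
    unfolding conj_def using that by (simp add: \<epsilon>\<theta>_comp D.Comp_in)
  have conj_Id: "conj a a (Id D a) = Id D (?F (r a))" if "a \<in> Obj D" for a
    using that by (simp add: conj_def D.Comp_Id_left \<theta>\<epsilon>)
  have conj_Comp: "conj a c (Comp D a b c k h) =
      Comp D (?F (r a)) (?F (r b)) (?F (r c)) (conj b c k) (conj a b h)"
    if "a \<in> Obj D" "b \<in> Obj D" "c \<in> Obj D" "h \<in> Hom D a b" "k \<in> Hom D b c" for a b c h k
  proof -
    have "Comp D (?F (r a)) (?F (r b)) (?F (r c)) (conj b c k) (conj a b h) =
        Comp D (?F (r a)) c (?F (r c)) (\<theta> c)
          (Comp D (?F (r a)) (?F (r b)) c (Comp D (?F (r b)) b c k (\<epsilon> b)) (conj a b h))"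
      unfolding conj_def[of b c]
      by (rule D.Comp_assoc) (use that conj in \<open>auto intro: D.Comp_in\<close>)
    also have "Comp D (?F (r a)) (?F (r b)) c (Comp D (?F (r b)) b c k (\<epsilon> b)) (conj a b h) =
        Comp D (?F (r a)) b c k (Comp D (?F (r a)) (?F (r b)) b (\<epsilon> b) (conj a b h))"
      by (rule D.Comp_assoc) (use that conj in auto)
    also have "\<dots> = Comp D (?F (r a)) a c (Comp D a b c k h) (\<epsilon> a)"
      unfolding \<epsilon>_conj[OF that(1,2,4)]
      by (rule D.Comp_assoc[symmetric]) (use that in auto)
    finally show ?thesis
      by (simp add: conj_def)
  qed
  define G where "G = \<lparr>omap = r, amap = (\<lambda>a b h. lift (r a) (r b) (conj a b h))\<rparr>"
  have oG [simp]: "omap G d = r d" for d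
    by (simp add: G_def)
  have aG: "amap G a b h \<in> Hom C (r a) (r b)" "amap F (r a) (r b) (amap G a b h) = conj a b h"
    if "a \<in> Obj D" "b \<in> Obj D" "h \<in> Hom D a b" for a b h
    using that by (simp_all add: G_def lift conj)
  have G: "is_functor D C G"
    unfolding is_functor_def
  proof (intro conjI ballI)
    fix a assume a: "a \<in> Obj D"
    show "amap G a a (Id D a) = Id C (omap G a)"
      by (rule faithful[of "r a" "r a"]) (use a in \<open>simp_all add: aG D.Id_in C.Id_in F_simps conj_Id\<close>)
  next
    fix a b c h k
    assume abc: "a \<in> Obj D" "b \<in> Obj D" "c \<in> Obj D" "h \<in> Hom D a b" "k \<in> Hom D b c"
    show "amap G a c (Comp D a b c k h) =
        Comp C (omap G a) (omap G b) (omap G c) (amap G b c k) (amap G a b h)"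
      unfolding oG
      by (rule faithful[of "r a" "r c"])
        (use abc in \<open>simp_all add: aG D.Comp_in C.Comp_in[of _ "r b"] F_simps conj_Comp\<close>)
  qed (simp_all add: aG)
  have "\<epsilon> d \<in> isos D (?F (r d)) d" if "d \<in> Obj D" for d
    unfolding isos_def using that \<theta>\<epsilon> \<epsilon>\<theta> by (auto intro!: bexI[where x = "\<theta> d"])
  then have "natural_iso D D (functor_comp F G) functor_id \<epsilon>"
    unfolding natural_iso_def by (simp add: functor_comp_def functor_id_def aG \<epsilon>_conj)
  moreover define \<eta> where "\<eta> a = lift a (r (?F a)) (\<theta> (?F a))" for a
  define \<zeta> where "\<zeta> a = lift (r (?F a)) a (\<epsilon> (?F a))" for a
  have \<eta>: "\<eta> a \<in> Hom C a (r (?F a))" "amap F a (r (?F a)) (\<eta> a) = \<theta> (?F a)"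
    and \<zeta>: "\<zeta> a \<in> Hom C (r (?F a)) a" "amap F (r (?F a)) a (\<zeta> a) = \<epsilon> (?F a)"
    if "a \<in> Obj C" for a
    using that by (simp_all add: \<eta>_def \<zeta>_def lift)
  have "\<eta> a \<in> isos C a (r (?F a))" if a: "a \<in> Obj C" for a
    unfolding isos_def
  proof (intro CollectI conjI bexI[where x = "\<zeta> a"])
    show "Comp C a (r (?F a)) a (\<zeta> a) (\<eta> a) = Id C a"
      by (rule faithful[of a a]) (use a in \<open>simp_all add: F_simps \<eta> \<zeta> \<epsilon>\<theta> C.Id_in C.Comp_in[of _ "r (?F a)"]\<close>)
    show "Comp C (r (?F a)) a (r (?F a)) (\<eta> a) (\<zeta> a) = Id C (r (?F a))"
      by (rule faithful[of "r (?F a)" "r (?F a)"])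
        (use a in \<open>simp_all add: F_simps \<eta> \<zeta> \<theta>\<epsilon> C.Id_in C.Comp_in[of _ a]\<close>)
  qed (use a in \<open>simp_all add: \<eta> \<zeta>\<close>)
  moreover have "Comp C a b (r (?F b)) (\<eta> b) f =
      Comp C a (r (?F a)) (r (?F b)) (amap G (?F a) (?F b) (amap F a b f)) (\<eta> a)"
    if ab: "a \<in> Obj C" "b \<in> Obj C" "f \<in> Hom C a b" for a b f
  proof (rule faithful[of a "r (?F b)"])
    have "Comp D (?F a) (?F (r (?F a))) (?F (r (?F b))) (conj (?F a) (?F b) (amap F a b f)) (\<theta> (?F a)) =
        Comp D (?F a) (?F b) (?F (r (?F b))) (\<theta> (?F b))
          (Comp D (?F a) (?F (r (?F a))) (?F b)
            (Comp D (?F (r (?F a))) (?F a) (?F b) (amap F a b f) (\<epsilon> (?F a))) (\<theta> (?F a)))"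
      unfolding conj_def by (rule D.Comp_assoc) (use ab in \<open>auto intro: D.Comp_in\<close>)
    also have "Comp D (?F a) (?F (r (?F a))) (?F b)
            (Comp D (?F (r (?F a))) (?F a) (?F b) (amap F a b f) (\<epsilon> (?F a))) (\<theta> (?F a)) =
        Comp D (?F a) (?F a) (?F b) (amap F a b f) (Comp D (?F a) (?F (r (?F a))) (?F a) (\<epsilon> (?F a)) (\<theta> (?F a)))"
      by (rule D.Comp_assoc) (use ab in auto)
    also have "\<dots> = amap F a b f"
      using ab by (simp add: \<epsilon>\<theta> D.Comp_Id_right)
    finally show "amap F a (r (?F b)) (Comp C a b (r (?F b)) (\<eta> b) f) =
        amap F a (r (?F b)) (Comp C a (r (?F a)) (r (?F b)) (amap G (?F a) (?F b) (amap F a b f)) (\<eta> a))"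
      using ab by (simp add: F_simps \<eta> aG)
  qed (use ab in \<open>simp_all add: \<eta> aG C.Comp_in[of _ b] C.Comp_in[of _ "r (?F a)"]\<close>)
  ultimately show ?thesis
    unfolding equivalent_categories_def
    using C D F G
    by (auto simp: natural_iso_def functor_comp_def functor_id_def
        intro!: exI[where x = F] exI[where x = G] exI[where x = \<eta>] exI[where x = \<epsilon>])
qed

section \<open>The categories of coverings\<close>

lemma xmod_hom_cong:
  assumes X: "crossed_module K X" and f: "(f1, f0) \<in> xmod_hom K X Y"
    and "\<And>m. m \<in> carrier (top_alg X) \<Longrightarrow> g1 m = f1 m" "\<And>x. x \<in> carrier (base_alg X) \<Longrightarrow> g0 x = f0 x"
  shows "(g1, g0) \<in> xmod_hom K X Y"
proof -
  interpret X: xmodule K X by unfold_locales fact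
  show ?thesis
    unfolding xmod_hom_def
    using assms(3,4) xmod_homD(3-5)[OF f]
      leibniz_hom_cong[OF xmod_homD(1)[OF f] X.top.leibniz_algebra_axioms]
      leibniz_hom_cong[OF xmod_homD(2)[OF f] X.base.leibniz_algebra_axioms]
    by simp
qed

lemma xmod_hom_comp:
  assumes f: "(f1, f0) \<in> xmod_hom K X Y" and g: "(g1, g0) \<in> xmod_hom K Y Z"
  shows "(\<lambda>m. g1 (f1 m), \<lambda>x. g0 (f0 x)) \<in> xmod_hom K X Z"
  unfolding xmod_hom_def
  using leibniz_hom_comp[OF xmod_homD(1)[OF f] xmod_homD(1)[OF g]]
    leibniz_hom_comp[OF xmod_homD(2)[OF f] xmod_homD(2)[OF g]]
  by (simp add: xmod_homD(3-5)[OF f] xmod_homD(3-5)[OF g]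
      leibniz_homD(1)[OF xmod_homD(1)[OF f]] leibniz_homD(1)[OF xmod_homD(2)[OF f]])

lemma xmod_hom_id: "(\<lambda>m. m, \<lambda>x. x) \<in> xmod_hom K X X"
  by (simp add: xmod_hom_def leibniz_hom_def)

lemma int_groupoid_hom_cong:
  assumes G: "internal_groupoid K G" and f: "(f, f0) \<in> int_groupoid_hom K G H"
    and "\<And>h. h \<in> carrier (mor_alg G) \<Longrightarrow> g h = f h" "\<And>x. x \<in> carrier (obj_alg G) \<Longrightarrow> g0 x = f0 x"
  shows "(g, g0) \<in> int_groupoid_hom K G H"
proof -
  interpret G: internal_grpd K G by unfold_locales fact
  show ?thesis
    unfolding int_groupoid_hom_def
    using assms(3,4) int_groupoid_homD(3-6)[OF f] G.comp_closed
      leibniz_hom_cong[OF int_groupoid_homD(1)[OF f] G.mor.leibniz_algebra_axioms]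
      leibniz_hom_cong[OF int_groupoid_homD(2)[OF f] G.obj.leibniz_algebra_axioms]
    by simp
qed

lemma int_groupoid_hom_comp:
  assumes f: "(f, f0) \<in> int_groupoid_hom K G H" and g: "(g, g0) \<in> int_groupoid_hom K H J"
  shows "(\<lambda>h. g (f h), \<lambda>x. g0 (f0 x)) \<in> int_groupoid_hom K G J"
  unfolding int_groupoid_hom_def
  using leibniz_hom_comp[OF int_groupoid_homD(1)[OF f] int_groupoid_homD(1)[OF g]]
    leibniz_hom_comp[OF int_groupoid_homD(2)[OF f] int_groupoid_homD(2)[OF g]]
  by (simp add: int_groupoid_homD(3-6)[OF f] int_groupoid_homD(3-6)[OF g]
      leibniz_homD(1)[OF int_groupoid_homD(1)[OF f]] leibniz_homD(1)[OF int_groupoid_homD(2)[OF f]])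

lemma int_groupoid_hom_id: "(\<lambda>h. h, \<lambda>x. x) \<in> int_groupoid_hom K G G"
  by (simp add: int_groupoid_hom_def leibniz_hom_def)

lemma inv_into_int_groupoid_hom:
  assumes G: "internal_groupoid K G" and f: "(f, f0) \<in> int_groupoid_hom K G H"
    and bij: "bij_betw f (carrier (mor_alg G)) (carrier (mor_alg H))"
    and bij0: "bij_betw f0 (carrier (obj_alg G)) (carrier (obj_alg H))"
  shows "(inv_into (carrier (mor_alg G)) f, inv_into (carrier (obj_alg G)) f0) \<in> int_groupoid_hom K H G"
proof -
  interpret G: internal_grpd K G by unfold_locales fact
  let ?A = "carrier (mor_alg G)" and ?B = "carrier (obj_alg G)"
  have inv: "inv_into ?A f (f h) = h" if "h \<in> ?A" for h
    using bij_betw_inv_into_left[OF bij that] .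
  have inv0: "inv_into ?B f0 (f0 x) = x" if "x \<in> ?B" for x
    using bij_betw_inv_into_left[OF bij0 that] .
  have mem: "f h \<in> carrier (mor_alg H)" if "h \<in> ?A" for h
    using leibniz_homD(1)[OF int_groupoid_homD(1)[OF f] that] .
  have composable: "src G h = tgt G g \<longleftrightarrow> f0 (src G h) = f0 (tgt G g)" if "h \<in> ?A" "g \<in> ?A" for h g
    using inj_on_eq_iff[OF bij_betw_imp_inj_on[OF bij0], of "src G h" "tgt G g"] that by simp
  show ?thesis
    unfolding int_groupoid_hom_def
    using inv_into_leibniz_hom[OF int_groupoid_homD(1)[OF f] bij G.mor.leibniz_algebra_axioms]
      inv_into_leibniz_hom[OF int_groupoid_homD(2)[OF f] bij0 G.obj.leibniz_algebra_axioms]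
    by (auto simp: inv inv0 int_groupoid_homD(3,4)[OF f] composable G.comp_closed
        simp flip: bij_betw_imp_surj_on[OF bij] bij_betw_imp_surj_on[OF bij0]
          int_groupoid_homD(5,6)[OF f])
qed

lemma Cov_XMod_simps:
  "(Y, p) \<in> Obj (Cov_XMod K X) \<longleftrightarrow> xmod_covering K X Y p"
  "(f1, f0) \<in> Hom (Cov_XMod K X) (Y, (p1, p0)) (Z, (q1, q0)) \<longleftrightarrow>
    (f1, f0) \<in> xmod_hom K Y Z \<and>
    f1 \<in> extensional (carrier (top_alg Y)) \<and> f0 \<in> extensional (carrier (base_alg Y)) \<and>
    (\<forall>m \<in> carrier (top_alg Y). q1 (f1 m) = p1 m) \<and>
    (\<forall>x \<in> carrier (base_alg Y). q0 (f0 x) = p0 x)"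
  "Id (Cov_XMod K X) (Y, p) = (restrict id (carrier (top_alg Y)), restrict id (carrier (base_alg Y)))"
  "Comp (Cov_XMod K X) (Y, p) b c (g1, g0) (f1, f0) =
    (compose (carrier (top_alg Y)) g1 f1, compose (carrier (base_alg Y)) g0 f0)"
  by (auto simp: Cov_XMod_def)

lemma Cov_Grpd_simps:
  "(H, pp) \<in> Obj (Cov_Grpd K G) \<longleftrightarrow> groupoid_covering K G H pp"
  "(f, f0) \<in> Hom (Cov_Grpd K G) (H, (p, p0)) (J, (q, q0)) \<longleftrightarrow>
    (f, f0) \<in> int_groupoid_hom K H J \<and>
    f \<in> extensional (carrier (mor_alg H)) \<and> f0 \<in> extensional (carrier (obj_alg H)) \<and>
    (\<forall>h \<in> carrier (mor_alg H). q (f h) = p h) \<and>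
    (\<forall>x \<in> carrier (obj_alg H). q0 (f0 x) = p0 x)"
  "Id (Cov_Grpd K G) (H, pp) = (restrict id (carrier (mor_alg H)), restrict id (carrier (obj_alg H)))"
  "Comp (Cov_Grpd K G) (H, pp) b c (g, g0) (f, f0) =
    (compose (carrier (mor_alg H)) g f, compose (carrier (obj_alg H)) g0 f0)"
  by (auto simp: Cov_Grpd_def)

lemma category_Cov_XMod: "category (Cov_XMod K X)"
proof
  fix a assume a: "a \<in> Obj (Cov_XMod K X)"
  obtain Y p1 p0 where Y: "a = (Y, (p1, p0))"
    by (metis surj_pair)
  then have "crossed_module K Y"
    using a by (simp add: Cov_XMod_simps xmod_covering_def)
  then show "Id (Cov_XMod K X) a \<in> Hom (Cov_XMod K X) a a"
    unfolding Y Cov_XMod_simps by (auto intro: xmod_hom_cong[OF _ xmod_hom_id])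
next
  fix a b c f g
  assume *: "a \<in> Obj (Cov_XMod K X)" "b \<in> Obj (Cov_XMod K X)" "c \<in> Obj (Cov_XMod K X)"
    "f \<in> Hom (Cov_XMod K X) a b" "g \<in> Hom (Cov_XMod K X) b c"
  obtain Y p1 p0 Z q1 q0 W s1 s0 f1 f0 g1 g0
    where eqs: "a = (Y, (p1, p0))" "b = (Z, (q1, q0))" "c = (W, (s1, s0))" "f = (f1, f0)" "g = (g1, g0)"
    by (metis surj_pair)
  have Y: "crossed_module K Y" and f: "(f1, f0) \<in> xmod_hom K Y Z" and g: "(g1, g0) \<in> xmod_hom K Z W"
    using * unfolding eqs by (simp_all add: Cov_XMod_simps xmod_covering_def)
  show "Comp (Cov_XMod K X) a b c g f \<in> Hom (Cov_XMod K X) a c"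
    using * leibniz_homD(1)[OF xmod_homD(1)[OF f]] leibniz_homD(1)[OF xmod_homD(2)[OF f]]
    unfolding eqs
    by (auto simp: Cov_XMod_simps compose_eq intro!: xmod_hom_cong[OF Y xmod_hom_comp[OF f g]])
next
  fix a b f
  assume *: "a \<in> Obj (Cov_XMod K X)" "b \<in> Obj (Cov_XMod K X)" "f \<in> Hom (Cov_XMod K X) a b"
  obtain Y p1 p0 Z q1 q0 f1 f0 where eqs: "a = (Y, (p1, p0))" "b = (Z, (q1, q0))" "f = (f1, f0)"
    by (metis surj_pair)
  have f: "(f1, f0) \<in> xmod_hom K Y Z"
    using * unfolding eqs by (simp add: Cov_XMod_simps)
  show "Comp (Cov_XMod K X) a a b f (Id (Cov_XMod K X) a) = f"
    "Comp (Cov_XMod K X) a b b (Id (Cov_XMod K X) b) f = f"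
    using * leibniz_homD(1)[OF xmod_homD(1)[OF f]] leibniz_homD(1)[OF xmod_homD(2)[OF f]]
    unfolding eqs
    by (auto simp: Cov_XMod_simps compose_eq intro!: extensionalityI[OF compose_extensional])
next
  fix a b c d f g h
  assume *: "f \<in> Hom (Cov_XMod K X) a b" "g \<in> Hom (Cov_XMod K X) b c" "h \<in> Hom (Cov_XMod K X) c d"
  obtain Y p1 p0 Z q1 q0 W s1 s0 f1 f0 g1 g0 h1 h0
    where eqs: "a = (Y, (p1, p0))" "b = (Z, (q1, q0))" "c = (W, (s1, s0))" "f = (f1, f0)"
      "g = (g1, g0)" "h = (h1, h0)"
    by (metis surj_pair)
  have f: "(f1, f0) \<in> xmod_hom K Y Z"
    using * unfolding eqs by (simp add: Cov_XMod_simps)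
  show "Comp (Cov_XMod K X) a b d (Comp (Cov_XMod K X) b c d h g) f =
      Comp (Cov_XMod K X) a c d h (Comp (Cov_XMod K X) a b c g f)"
    using leibniz_homD(1)[OF xmod_homD(1)[OF f]] leibniz_homD(1)[OF xmod_homD(2)[OF f]]
    unfolding eqs
    by (auto simp: Cov_XMod_simps compose_eq intro!: extensionalityI[OF compose_extensional compose_extensional])
qed

lemma category_Cov_Grpd: "category (Cov_Grpd K G)"
proof
  fix a assume a: "a \<in> Obj (Cov_Grpd K G)"
  obtain H p p0 where H: "a = (H, (p, p0))"
    by (metis surj_pair)
  then have "internal_groupoid K H"
    using a by (simp add: Cov_Grpd_simps groupoid_covering_def)
  then show "Id (Cov_Grpd K G) a \<in> Hom (Cov_Grpd K G) a a"
    unfolding H Cov_Grpd_simps by (auto intro: int_groupoid_hom_cong[OF _ int_groupoid_hom_id])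
next
  fix a b c f g
  assume *: "a \<in> Obj (Cov_Grpd K G)" "b \<in> Obj (Cov_Grpd K G)" "c \<in> Obj (Cov_Grpd K G)"
    "f \<in> Hom (Cov_Grpd K G) a b" "g \<in> Hom (Cov_Grpd K G) b c"
  obtain H p p0 J q q0 I s s0 f1 f0 g1 g0
    where eqs: "a = (H, (p, p0))" "b = (J, (q, q0))" "c = (I, (s, s0))" "f = (f1, f0)" "g = (g1, g0)"
    by (metis surj_pair)
  have H: "internal_groupoid K H" and f: "(f1, f0) \<in> int_groupoid_hom K H J"
    and g: "(g1, g0) \<in> int_groupoid_hom K J I"
    using * unfolding eqs by (simp_all add: Cov_Grpd_simps groupoid_covering_def)
  show "Comp (Cov_Grpd K G) a b c g f \<in> Hom (Cov_Grpd K G) a c"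
    using * leibniz_homD(1)[OF int_groupoid_homD(1)[OF f]] leibniz_homD(1)[OF int_groupoid_homD(2)[OF f]]
    unfolding eqs
    by (auto simp: Cov_Grpd_simps compose_eq intro!: int_groupoid_hom_cong[OF H int_groupoid_hom_comp[OF f g]])
next
  fix a b f
  assume *: "a \<in> Obj (Cov_Grpd K G)" "b \<in> Obj (Cov_Grpd K G)" "f \<in> Hom (Cov_Grpd K G) a b"
  obtain H p p0 J q q0 f1 f0 where eqs: "a = (H, (p, p0))" "b = (J, (q, q0))" "f = (f1, f0)"
    by (metis surj_pair)
  have f: "(f1, f0) \<in> int_groupoid_hom K H J"
    using * unfolding eqs by (simp add: Cov_Grpd_simps)
  show "Comp (Cov_Grpd K G) a a b f (Id (Cov_Grpd K G) a) = f"
    "Comp (Cov_Grpd K G) a b b (Id (Cov_Grpd K G) b) f = f"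
    using * leibniz_homD(1)[OF int_groupoid_homD(1)[OF f]] leibniz_homD(1)[OF int_groupoid_homD(2)[OF f]]
    unfolding eqs
    by (auto simp: Cov_Grpd_simps compose_eq intro!: extensionalityI[OF compose_extensional])
next
  fix a b c d f g h
  assume *: "f \<in> Hom (Cov_Grpd K G) a b" "g \<in> Hom (Cov_Grpd K G) b c" "h \<in> Hom (Cov_Grpd K G) c d"
  obtain H p p0 J q q0 I s s0 f1 f0 g1 g0 h1 h0
    where eqs: "a = (H, (p, p0))" "b = (J, (q, q0))" "c = (I, (s, s0))" "f = (f1, f0)"
      "g = (g1, g0)" "h = (h1, h0)"
    by (metis surj_pair)
  have f: "(f1, f0) \<in> int_groupoid_hom K H J"
    using * unfolding eqs by (simp add: Cov_Grpd_simps)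
  show "Comp (Cov_Grpd K G) a b d (Comp (Cov_Grpd K G) b c d h g) f =
      Comp (Cov_Grpd K G) a c d h (Comp (Cov_Grpd K G) a b c g f)"
    using leibniz_homD(1)[OF int_groupoid_homD(1)[OF f]] leibniz_homD(1)[OF int_groupoid_homD(2)[OF f]]
    unfolding eqs
    by (auto simp: Cov_Grpd_simps compose_eq intro!: extensionalityI[OF compose_extensional compose_extensional])
qed

lemma isos_Cov_GrpdI:
  assumes H: "internal_groupoid K H"
    and f: "(f, f0) \<in> Hom (Cov_Grpd K G) (H, (p, p0)) (J, (q, q0))"
    and bij: "bij_betw f (carrier (mor_alg H)) (carrier (mor_alg J))"
    and bij0: "bij_betw f0 (carrier (obj_alg H)) (carrier (obj_alg J))"
    and J: "internal_groupoid K J"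
  shows "(f, f0) \<in> isos (Cov_Grpd K G) (H, (p, p0)) (J, (q, q0))"
proof -
  let ?g = "restrict (inv_into (carrier (mor_alg H)) f) (carrier (mor_alg J))"
  let ?k = "restrict (inv_into (carrier (obj_alg H)) f0) (carrier (obj_alg J))"
  have f_hom: "(f, f0) \<in> int_groupoid_hom K H J"
    and over: "\<And>h. h \<in> carrier (mor_alg H) \<Longrightarrow> q (f h) = p h"
      "\<And>x. x \<in> carrier (obj_alg H) \<Longrightarrow> q0 (f0 x) = p0 x"
    using f by (simp_all add: Cov_Grpd_simps)
  note left = bij_betw_inv_into_left[OF bij] bij_betw_inv_into_left[OF bij0]
    and right = bij_betw_inv_into_right[OF bij] bij_betw_inv_into_right[OF bij0]
    and mem = bij_betw_apply[OF bij] bij_betw_apply[OF bij0]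
      bij_betw_apply[OF bij_betw_inv_into[OF bij]] bij_betw_apply[OF bij_betw_inv_into[OF bij0]]
  have "(?g, ?k) \<in> int_groupoid_hom K J H"
    by (rule int_groupoid_hom_cong[OF J inv_into_int_groupoid_hom[OF H f_hom bij bij0]]) simp_all
  then have "(?g, ?k) \<in> Hom (Cov_Grpd K G) (J, (q, q0)) (H, (p, p0))"
    by (simp add: Cov_Grpd_simps mem right flip: over)
  moreover have "Comp (Cov_Grpd K G) (H, (p, p0)) (J, (q, q0)) (H, (p, p0)) (?g, ?k) (f, f0) =
      Id (Cov_Grpd K G) (H, (p, p0))"
    "Comp (Cov_Grpd K G) (J, (q, q0)) (H, (p, p0)) (J, (q, q0)) (f, f0) (?g, ?k) =
      Id (Cov_Grpd K G) (J, (q, q0))"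
    by (auto simp: Cov_Grpd_simps compose_def left right mem intro!: restrict_ext)
  ultimately show ?thesis
    using f by (auto simp: isos_def)
qed

section \<open>The equivalence\<close>

definition cov_functor ::
  "('u \<times> 'u \<Rightarrow> 'u) \<Rightarrow> (('k, 'u, 'a, 'b) xmod_over, 'u map_pair,
    ('k, 'u, 'a \<times> 'b, 'b) groupoid_over, 'u map_pair) cat_map" where
  "cov_functor e =
    \<lparr>omap = (\<lambda>(Y, (p1, p0)). (relabel_groupoid e (groupoid_of_xmod Y),
        (\<lambda>h. map_prod p1 p0 (inv_into UNIV e h), p0))),
     amap = (\<lambda>(Y, p) _ (f1, f0).
        (restrict (\<lambda>h. e (map_prod f1 f0 (inv_into UNIV e h)))
          (carrier (mor_alg (relabel_groupoid e (groupoid_of_xmod Y)))), f0))\<rparr>"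

lemma cov_functor_simps:
  "omap (cov_functor e) (Y, (p1, p0)) = (relabel_groupoid e (groupoid_of_xmod Y),
    (\<lambda>h. map_prod p1 p0 (inv_into UNIV e h), p0))"
  "inj e \<Longrightarrow> amap (cov_functor e) (Y, p) b (f1, f0) =
    (restrict (\<lambda>h. e (map_prod f1 f0 (inv_into UNIV e h)))
      (e ` (carrier (top_alg Y) \<times> carrier (base_alg Y))), f0)"
  by (simp_all add: cov_functor_def relabel_groupoid_simps relabel_algebra_simps)

lemma is_functor_cov_functor:
  assumes X: "crossed_module K X" and e: "inj e"
  shows "is_functor (Cov_XMod K X) (Cov_Grpd K (groupoid_of_xmod X)) (cov_functor e)"
    (is "is_functor ?C ?D ?F")
  unfolding is_functor_def
proof (intro conjI ballI)
  fix a assume a: "a \<in> Obj ?C"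
  obtain Y p1 p0 where Y: "a = (Y, (p1, p0))"
    by (metis surj_pair)
  show "omap ?F a \<in> Obj ?D"
    using a groupoid_covering_relabel[OF groupoid_covering_of_xmod[OF X] e]
    unfolding Y cov_functor_simps Cov_XMod_simps Cov_Grpd_simps by blast
  show "amap ?F a a (Id ?C a) = Id ?D (omap ?F a)"
    unfolding Y by (auto simp: cov_functor_simps e Cov_XMod_simps Cov_Grpd_simps relabel_groupoid_simps
        relabel_algebra_simps restrict_def fun_eq_iff)
next
  fix a b f assume *: "a \<in> Obj ?C" "b \<in> Obj ?C" "f \<in> Hom ?C a b"
  obtain Y p1 p0 Z q1 q0 f1 f0 where eqs: "a = (Y, (p1, p0))" "b = (Z, (q1, q0))" "f = (f1, f0)"
    by (metis surj_pair)
  have Y: "crossed_module K Y" and Z: "crossed_module K Z" and f: "(f1, f0) \<in> xmod_hom K Y Z"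
    using * unfolding eqs by (simp_all add: Cov_XMod_simps xmod_covering_def)
  have GY: "internal_groupoid K (groupoid_of_xmod Y)"
    using xmodule.internal_groupoid_of_xmod[OF xmodule.intro[OF Y]] .
  have "(\<lambda>h. e (map_prod f1 f0 h), f0) \<in>
      int_groupoid_hom K (groupoid_of_xmod Y) (relabel_groupoid e (groupoid_of_xmod Z))"
    using groupoid_hom_of_xmod_hom[OF Y Z f] by (simp add: int_groupoid_hom_relabel_cod e)
  then have "(restrict (\<lambda>h. e (map_prod f1 f0 (inv_into UNIV e h)))
        (e ` (carrier (top_alg Y) \<times> carrier (base_alg Y))), f0) \<in>
      int_groupoid_hom K (relabel_groupoid e (groupoid_of_xmod Y)) (relabel_groupoid e (groupoid_of_xmod Z))"
    by (subst int_groupoid_hom_relabel_dom[OF e], elim int_groupoid_hom_cong[OF GY]) (auto simp: e)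
  then show "amap ?F a b f \<in> Hom ?D (omap ?F a) (omap ?F b)"
    using * unfolding eqs
    by (auto simp: cov_functor_simps e Cov_XMod_simps Cov_Grpd_simps relabel_groupoid_simps
        relabel_algebra_simps)
next
  fix a b c f g
  assume *: "f \<in> Hom ?C a b" "g \<in> Hom ?C b c"
  obtain Y p1 p0 Z q1 q0 W s1 s0 f1 f0 g1 g0
    where eqs: "a = (Y, (p1, p0))" "b = (Z, (q1, q0))" "c = (W, (s1, s0))" "f = (f1, f0)" "g = (g1, g0)"
    by (metis surj_pair)
  have f: "(f1, f0) \<in> xmod_hom K Y Z"
    using * unfolding eqs by (simp add: Cov_XMod_simps)
  show "amap ?F a c (Comp ?C a b c g f) =
      Comp ?D (omap ?F a) (omap ?F b) (omap ?F c) (amap ?F b c g) (amap ?F a b f)"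
    using leibniz_homD(1)[OF xmod_homD(1)[OF f]] leibniz_homD(1)[OF xmod_homD(2)[OF f]]
    unfolding eqs
    by (auto simp: cov_functor_simps e Cov_XMod_simps Cov_Grpd_simps relabel_groupoid_simps
        relabel_algebra_simps compose_def restrict_def fun_eq_iff)
qed

lemma cov_functor_fully_faithful:
  assumes e: "inj e" and a: "a \<in> Obj (Cov_XMod K X)" and b: "b \<in> Obj (Cov_XMod K X)"
    and F: "is_functor (Cov_XMod K X) (Cov_Grpd K (groupoid_of_xmod X)) (cov_functor e)"
  shows "bij_betw (amap (cov_functor e) a b) (Hom (Cov_XMod K X) a b)
    (Hom (Cov_Grpd K (groupoid_of_xmod X)) (omap (cov_functor e) a) (omap (cov_functor e) b))"
    (is "bij_betw ?f (Hom ?C a b) (Hom ?D ?Fa ?Fb)")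
proof -
  obtain Y p1 p0 Z q1 q0 where eqs: "a = (Y, (p1, p0))" "b = (Z, (q1, q0))"
    by (metis surj_pair)
  have Y: "crossed_module K Y" and Z: "crossed_module K Z"
    using a b unfolding eqs by (simp_all add: Cov_XMod_simps xmod_covering_def)
  interpret Y: xmodule K Y by unfold_locales fact
  have "f = f'" if f: "f \<in> Hom ?C a b" and f': "f' \<in> Hom ?C a b" and eq: "?f f = ?f f'" for f f'
  proof -
    obtain f1 f0 f1' f0' where fs: "f = (f1, f0)" "f' = (f1', f0')"
      by (metis surj_pair)
    have "f1 m = f1' m" if "m \<in> carrier (top_alg Y)" for m
    proof -
      have "fst (?f f) (e (m, \<zero>\<^bsub>base_alg Y\<^esub>)) = fst (?f f') (e (m, \<zero>\<^bsub>base_alg Y\<^esub>))"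
        using eq by simp
      then show ?thesis
        using that unfolding fs eqs by (simp add: cov_functor_simps e inj_eq inj_image_mem_iff)
    qed
    moreover have "f0 = f0'"
      using eq unfolding fs eqs by (simp add: cov_functor_simps e)
    ultimately show ?thesis
      using f f' unfolding fs eqs by (auto simp: Cov_XMod_simps intro: extensionalityI)
  qed
  moreover have "g \<in> ?f ` Hom ?C a b" if g: "g \<in> Hom ?D ?Fa ?Fb" for g
  proof -
    obtain g1 g0 where g_eq: "g = (g1, g0)"
      by (metis surj_pair)
    let ?GY = "groupoid_of_xmod Y" and ?GZ = "groupoid_of_xmod Z"
    have g_hom: "(g1, g0) \<in> int_groupoid_hom K (relabel_groupoid e ?GY) (relabel_groupoid e ?GZ)"
      and g_ext: "g1 \<in> extensional (e ` (carrier (top_alg Y) \<times> carrier (base_alg Y)))"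
        "g0 \<in> extensional (carrier (base_alg Y))"
      and g_over: "\<And>m x. \<lbrakk>m \<in> carrier (top_alg Y); x \<in> carrier (base_alg Y)\<rbrakk> \<Longrightarrow>
          map_prod q1 q0 (inv_into UNIV e (g1 (e (m, x)))) = (p1 m, p0 x)"
        "\<And>x. x \<in> carrier (base_alg Y) \<Longrightarrow> q0 (g0 x) = p0 x"
      using g unfolding g_eq eqs
      by (auto simp: cov_functor_simps Cov_Grpd_simps relabel_groupoid_simps relabel_algebra_simps e)
    define d where "d h = inv_into UNIV e (g1 (e h))" for h
    have g1_e: "g1 (e (m, x)) = e (d (m, x))"
      if "m \<in> carrier (top_alg Y)" "x \<in> carrier (base_alg Y)" for m x
    proof -
      have "g1 (e (m, x)) \<in> e ` carrier (mor_alg ?GZ)"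
        using leibniz_homD(1)[OF int_groupoid_homD(1)[OF g_hom], of "e (m, x)"] that
        by (simp add: relabel_groupoid_simps relabel_algebra_simps e inj_image_mem_iff)
      then show ?thesis
        by (auto simp: d_def e)
    qed
    have "(\<lambda>h. g1 (e h), g0) \<in> int_groupoid_hom K ?GY (relabel_groupoid e ?GZ)"
      using g_hom by (simp add: int_groupoid_hom_relabel_dom e)
    then have "(\<lambda>h. e (d h), g0) \<in> int_groupoid_hom K ?GY (relabel_groupoid e ?GZ)"
      by (rule int_groupoid_hom_cong[OF Y.internal_groupoid_of_xmod]) (auto simp: g1_e)
    then have d: "(d, g0) \<in> int_groupoid_hom K ?GY ?GZ"
      by (simp add: int_groupoid_hom_relabel_cod e)
    define f1 where "f1 = restrict (\<lambda>m. fst (d (m, \<zero>\<^bsub>base_alg Y\<^esub>))) (carrier (top_alg Y))"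
    have f_hom: "(f1, g0) \<in> xmod_hom K Y Z"
      by (rule xmod_hom_cong[OF Y groupoid_hom_imp_xmod_hom(1)[OF Y Z d]]) (simp_all add: f1_def)
    have d_eq: "d (m, x) = (f1 m, g0 x)" if "m \<in> carrier (top_alg Y)" "x \<in> carrier (base_alg Y)" for m x
      using groupoid_hom_imp_xmod_hom(2)[OF Y Z d that] that by (simp add: f1_def)
    have "q1 (f1 m) = p1 m" if "m \<in> carrier (top_alg Y)" for m
      using g_over(1)[OF that Y.base.zero_closed] d_eq[OF that Y.base.zero_closed] by (simp flip: d_def)
    then have "(f1, g0) \<in> Hom ?C a b"
      unfolding eqs using f_hom g_ext(2) g_over(2) by (simp add: Cov_XMod_simps f1_def)
    moreover have "?f (f1, g0) = (g1, g0)"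
      using g_ext(1) unfolding eqs
      by (auto simp: cov_functor_simps e g1_e d_eq restrict_def extensional_def fun_eq_iff)
    ultimately show ?thesis
      unfolding g_eq by (metis imageI)
  qed
  ultimately show ?thesis
    using is_functorD(2)[OF F a b] by (auto simp: bij_betw_def inj_on_def)
qed

lemma cov_functor_ess_surj:
  assumes X: "crossed_module K X" and e: "inj e" and d: "d \<in> Obj (Cov_Grpd K (groupoid_of_xmod X))"
  shows "\<exists>a \<in> Obj (Cov_XMod K X). isos (Cov_Grpd K (groupoid_of_xmod X)) (omap (cov_functor e) a) d \<noteq> {}"
proof -
  obtain H p p0 where d_eq: "d = (H, (p, p0))"
    by (metis surj_pair)
  have cov: "groupoid_covering K (groupoid_of_xmod X) H (p, p0)"
    using d unfolding d_eq by (simp add: Cov_Grpd_simps)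
  then interpret H: internal_grpd K H
    by unfold_locales (simp add: groupoid_covering_def)
  define Y where "Y = xmod_of_groupoid H"
  let ?GY = "groupoid_of_xmod Y" and ?p1 = "\<lambda>m. fst (p m)"
  let ?R = "relabel_groupoid e ?GY"
  define \<phi> where "\<phi> = (\<lambda>(m, x). m \<oplus>\<^bsub>mor_alg H\<^esub> ident H x)"
  define \<psi> where "\<psi> = restrict (\<lambda>h. \<phi> (inv_into UNIV e h)) (carrier (mor_alg ?R))"
  define \<iota> where "\<iota> = restrict id (carrier (obj_alg H))"
  have Y_xmod: "crossed_module K Y"
    unfolding Y_def by (rule H.crossed_module_of_groupoid)
  have GY: "internal_groupoid K ?GY"
    using xmodule.internal_groupoid_of_xmod[OF xmodule.intro[OF Y_xmod]] .
  have R: "internal_groupoid K ?R"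
    by (rule internal_groupoid_relabel[OF GY e])
  have carrier_R: "carrier (mor_alg ?R) = e ` carrier (mor_alg ?GY)" "obj_alg ?R = obj_alg H"
    by (simp_all add: relabel_groupoid_simps relabel_algebra_simps e) (simp add: Y_def)
  have \<psi>_e: "\<psi> (e h) = \<phi> h" if "h \<in> carrier (mor_alg ?GY)" for h
    using that e by (simp add: \<psi>_def carrier_R inj_image_mem_iff)
  have "(\<phi>, \<lambda>x. x) \<in> int_groupoid_hom K ?GY H"
    unfolding \<phi>_def Y_def by (rule H.semidirect_splitting_hom)
  then have "(\<lambda>h. \<psi> (e h), \<iota>) \<in> int_groupoid_hom K ?GY H"
    by (rule int_groupoid_hom_cong[OF GY]) (simp_all add: \<psi>_e \<iota>_def Y_def)
  then have \<psi>_hom: "(\<psi>, \<iota>) \<in> int_groupoid_hom K ?R H"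
    by (simp add: int_groupoid_hom_relabel_dom e)
  have p_\<phi>: "p (\<phi> h) = map_prod ?p1 p0 h" if "h \<in> carrier (mor_alg ?GY)" for h
    using that xmod_covering_of_groupoid(2)[OF X cov] by (auto simp: Y_def \<phi>_def)
  have "bij_betw \<phi> (carrier (mor_alg ?GY)) (carrier (mor_alg H))"
    unfolding \<phi>_def Y_def by (rule H.semidirect_splitting_bij)
  then have "bij_betw (\<lambda>h. \<psi> (e h)) (carrier (mor_alg ?GY)) (carrier (mor_alg H))"
    using bij_betw_cong[of "carrier (mor_alg ?GY)" "\<lambda>h. \<psi> (e h)" \<phi>] \<psi>_e by blast
  then have bij: "bij_betw \<psi> (carrier (mor_alg ?R)) (carrier (mor_alg H))"
    unfolding carrier_R
    using bij_betw_comp_iff[OF inj_on_imp_bij_betw[OF inj_on_subset[OF e subset_UNIV]],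
        where f' = \<psi> and A'' = "carrier (mor_alg H)"]
    by (simp add: comp_def)
  have bij0: "bij_betw \<iota> (carrier (obj_alg ?R)) (carrier (obj_alg H))"
    by (simp add: carrier_R \<iota>_def bij_betw_def inj_on_def)
  have "(\<psi>, \<iota>) \<in> Hom (Cov_Grpd K (groupoid_of_xmod X)) (omap (cov_functor e) (Y, (?p1, p0))) d"
    unfolding d_eq cov_functor_simps Cov_Grpd_simps
    using \<psi>_hom by (auto simp: carrier_R \<psi>_e p_\<phi> e) (auto simp: \<psi>_def carrier_R \<iota>_def)
  then have "(\<psi>, \<iota>) \<in> isos (Cov_Grpd K (groupoid_of_xmod X)) (omap (cov_functor e) (Y, (?p1, p0))) d"
    unfolding d_eq cov_functor_simps
    by (rule isos_Cov_GrpdI[OF R _ bij bij0 H.internal_groupoid])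
  moreover have "(Y, (?p1, p0)) \<in> Obj (Cov_XMod K X)"
    unfolding Y_def Cov_XMod_simps by (rule xmod_covering_of_groupoid(1)[OF X cov])
  ultimately show ?thesis
    by blast
qed

theorem proposition5p3:
  fixes K :: "'k ring" and X :: "('k, 'a, 'b) xmod"
  assumes "field K"
    and "crossed_module K X"
    and "infinite (UNIV :: 'u set)"
  shows "equivalent_categories
    (Cov_XMod K X :: (('k, 'u, 'a, 'b) xmod_over, 'u map_pair) cat)
    (Cov_Grpd K (groupoid_of_xmod X) :: (('k, 'u, 'a \<times> 'b, 'b) groupoid_over, 'u map_pair) cat)"
proof -
  obtain e :: "'u \<times> 'u \<Rightarrow> 'u" where "bij_betw e (UNIV \<times> UNIV) UNIV"
    using card_of_Times_same_infinite[OF assms(3)] card_of_ordIso by blast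
  then have e: "inj e"
    by (simp add: bij_betw_def)
  have F: "is_functor (Cov_XMod K X) (Cov_Grpd K (groupoid_of_xmod X)) (cov_functor e)"
    by (rule is_functor_cov_functor[OF assms(2) e])
  show ?thesis
    by (rule equivalent_categoriesI[OF category_Cov_XMod category_Cov_Grpd F
          cov_functor_fully_faithful[OF e _ _ F] cov_functor_ess_surj[OF assms(2) e]])
qed

end
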